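(* Let $S$ be a finitely generated, commutative, reduced and cancellative semigroup with zero element, minimally generated by a disjoint union $A_1\sqcup A_2$ of nonempty finite sets $A_1=\{a_1,\dots,a_r\}$ and $A_2=\{b_1,\dots,b_t\}$, and put $S_1=\langle A_1\rangle$ and $S_2=\langle A_2\rangle$. Then $S$ is the gluing of $S_1$ and $S_2$ if and only if the following conditions are fulfilled: 1. For all $d'\in Betti(S)$, every connected component of $\nabla_{d'}$ contains at least one pure monomial. 2. There exists a unique $d\in Betti(S)$ such that $C_d^{A_1}\neq\emptyset\neq C_d^{A_2}$ and all the elements of $C_d$ are pure monomials. 3. For all $d'\in Betti(S)\setminus\{d\}$ with $C_{d'}^{A_1}\neq\emptyset\neq C_{d'}^{A_2}$, one has $d'\in d\mathbb{N}$ (where $d$ is the element of condition 2). Moreover, in this case the element $d\in Betti(S)$ of condition 2 is the glued degree.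
   Context: Semigroups are commutative with zero. $S$ is cancellative if $m+n=m+n'$ implies $n=n'$, and reduced if $S\cap(-S)=\{0\}$; $S$ need not be torsion-free. "Minimally generated" means no proper subset of the generating set generates $S$. Let $\Bbbk$ be a field. The polynomial ring $\Bbbk[X_1,\dots,X_r,Y_1,\dots,Y_t]$ is $S$-graded by giving $X_i$ degree $a_i$ and $Y_j$ degree $b_j$. The semigroup ideal $I_S$ is the ($S$-homogeneous) ideal generated by all differences of two monomials of the same $S$-degree; $I_{S_1}\subset\Bbbk[X_1,\dots,X_r]$ and $I_{S_2}\subset\Bbbk[Y_1,\dots,Y_t]$ are defined likewise from $A_1$, $A_2$. $Betti(S)$ is the set of $S$-degrees of the elements of a minimal ($S$-homogeneous, binomial) generating set of $I_S$ (independent of the choice, by Nakayama's lemma). Definition (gluing). $S$ is the gluing of $S_1$ and $S_2$ if there is a nonzero binomial $X^{\gamma_X}-Y^{\gamma_Y}\in I_S$, with $\gamma_X\in\mathbb{N}^r$, $\gamma_Y\in\mathbb{N}^t$, such that $I_S=I_{S_1}+I_{S_2}+\langle X^{\gamma_X}-Y^{\gamma_Y}\rangle$. Such a binomial is called a glued binomial, and its $S$-degree $\sum_i\gamma_{Xi}a_i$ is called the glued degree (it is uniquely determined by the partition $A_1\sqcup A_2$). For $m\in S$: $C_m$ is the set of monomials $X^\alpha Y^\beta$ of $S$-degree $m$; $C_m^{A_1}$ is the set of monomials in $C_m$ involving only $X_1,\dots,X_r$; $C_m^{A_2}$ is the set of monomials in $C_m$ involving only $Y_1,\dots,Y_t$.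 $\nabla_m$ is the simplicial complex $\{F\subseteq C_m\mid \gcd(F)\neq 1\}$, where $\gcd(F)$ is the greatest common divisor of the monomials in $F$. A monomial is pure if it involves only the indeterminates $X_1,\dots,X_r$ or only the indeterminates $Y_1,\dots,Y_t$; otherwise it is mixed. $d\mathbb{N}=\{kd\mid k\in\mathbb{N}\}$. *)

theory Defs
  imports Complex_Main "HOL-Library.Poly_Mapping" "HOL-Library.Set_Algebras"
begin

section \<open>Commutative semigroups with zero\<close>

inductive_set generated :: "'a::comm_monoid_add set \<Rightarrow> 'a set" for A where
  zero: "0 \<in> generated A"
| incl: "x \<in> A \<Longrightarrow> x \<in> generated A"
| add: "x \<in> generated A \<Longrightarrow> y \<in> generated A \<Longrightarrow> x + y \<in> generated A"

definition minimally_generated :: "'a::comm_monoid_add set \<Rightarrow> 'a set \<Rightarrow> bool" where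
  "minimally_generated S A \<longleftrightarrow> S = generated A \<and> (\<forall>B. B \<subset> A \<longrightarrow> generated B \<noteq> S)"

definition cancellative :: "'a::comm_monoid_add set \<Rightarrow> bool" where
  "cancellative S \<longleftrightarrow> (\<forall>m\<in>S. \<forall>n\<in>S. \<forall>n'\<in>S. m + n = m + n' \<longrightarrow> n = n')"

text \<open>The ambient type need not have negatives, so \<open>x \<in> S \<inter> (-S)\<close> is written as
  \<open>x \<in> S\<close> having an additive inverse \<open>y \<in> S\<close>.\<close>

definition reduced :: "'a::comm_monoid_add set \<Rightarrow> bool" where
  "reduced S \<longleftrightarrow> {x \<in> S. \<exists>y\<in>S. x + y = 0} = {0}"

definition multiple :: "nat \<Rightarrow> 'a::comm_monoid_add \<Rightarrow> 'a" where
  "multiple n x = (\<Sum>i<n. x)"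

section \<open>Monomials and polynomials\<close>

text \<open>A monomial is encoded by its exponent vector, so the monomial \<open>1\<close> is the exponent
  vector \<open>0\<close>, and the product of monomials is addition of exponent vectors.\<close>

type_synonym 'v monomial = "'v \<Rightarrow>\<^sub>0 nat"
type_synonym ('v, 'k) mpoly = "'v monomial \<Rightarrow>\<^sub>0 'k"

definition monom_poly :: "'v monomial \<Rightarrow> ('v, 'k::comm_ring_1) mpoly" where
  "monom_poly u = Poly_Mapping.single u 1"

definition push :: "('v \<Rightarrow> 'w) \<Rightarrow> ('v \<Rightarrow>\<^sub>0 'c::comm_monoid_add) \<Rightarrow> 'w \<Rightarrow>\<^sub>0 'c" where
  "push f p = (\<Sum>x\<in>Poly_Mapping.keys p. Poly_Mapping.single (f x) (Poly_Mapping.lookup p x))"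

text \<open>Renaming indeterminates along \<open>f\<close>: on monomials this is \<open>push f\<close>. For \<open>f = Inl\<close> and
  \<open>f = Inr\<close> the following are the inclusions of \<open>k[X]\<close> and \<open>k[Y]\<close> into \<open>k[X,Y]\<close>.\<close>

definition rename_poly :: "('v \<Rightarrow> 'w) \<Rightarrow> ('v, 'k::comm_ring_1) mpoly \<Rightarrow> ('w, 'k) mpoly" where
  "rename_poly f = push (push f)"

text \<open>Ideals are the submodules of a ring regarded as a module over itself.\<close>

lemma module_times: "module ((*) :: 'r::comm_ring_1 \<Rightarrow> 'r \<Rightarrow> 'r)"
  by unfold_locales (simp_all add: algebra_simps)

definition ideal_gen :: "'r::comm_ring_1 set \<Rightarrow> 'r set" where
  "ideal_gen B = module.span (*) B"

section \<open>The semigroup ideal and Betti degrees\<close>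

text \<open>Here and below \<open>g\<close> gives the degrees of the indeterminates.\<close>

definition mdegree :: "('v::finite \<Rightarrow> 'a::comm_monoid_add) \<Rightarrow> 'v monomial \<Rightarrow> 'a" where
  "mdegree g u = (\<Sum>i\<in>UNIV. multiple (Poly_Mapping.lookup u i) (g i))"

definition semigroup_ideal :: "('v::finite \<Rightarrow> 'a::comm_monoid_add) \<Rightarrow> ('v, 'k::field) mpoly set" where
  "semigroup_ideal g = ideal_gen {monom_poly u - monom_poly v | u v. mdegree g u = mdegree g v}"

definition homogeneous ::
    "('v::finite \<Rightarrow> 'a::comm_monoid_add) \<Rightarrow> 'a \<Rightarrow> ('v, 'k::field) mpoly \<Rightarrow> bool" where
  "homogeneous g m f \<longleftrightarrow> (\<forall>u\<in>Poly_Mapping.keys f. mdegree g u = m)"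

definition is_binomial :: "('v, 'k::field) mpoly \<Rightarrow> bool" where
  "is_binomial f \<longleftrightarrow> (\<exists>u v. u \<noteq> v \<and> f = monom_poly u - monom_poly v)"

definition minimal_binomial_generators ::
    "('v::finite \<Rightarrow> 'a::comm_monoid_add) \<Rightarrow> ('v, 'k::field) mpoly set \<Rightarrow> bool" where
  "minimal_binomial_generators g B \<longleftrightarrow>
     (\<forall>f\<in>B. is_binomial f \<and> (\<exists>m. homogeneous g m f)) \<and>
     ideal_gen B = semigroup_ideal g \<and>
     (\<forall>B'. B' \<subset> B \<longrightarrow> ideal_gen B' \<noteq> semigroup_ideal g)"

text \<open>All minimal generating sets have the same degrees, so the existential quantifier over
  \<open>B\<close> amounts to fixing any one of them.\<close>

definition Betti ::
    "'k::field itself \<Rightarrow> ('v::finite \<Rightarrow> 'a::comm_monoid_add) \<Rightarrow> 'a set" where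
  "Betti K g = {m. \<exists>B :: ('v, 'k) mpoly set.
     minimal_binomial_generators g B \<and> (\<exists>f\<in>B. homogeneous g m f)}"

section \<open>The complexes of monomials of given degree\<close>

definition fibre :: "('v::finite \<Rightarrow> 'a::comm_monoid_add) \<Rightarrow> 'a \<Rightarrow> 'v monomial set" where
  "fibre g m = {u. mdegree g u = m}"

definition monomial_gcd :: "'v::finite monomial set \<Rightarrow> 'v monomial" where
  "monomial_gcd F = Abs_poly_mapping (\<lambda>i. INF u\<in>F. Poly_Mapping.lookup u i)"

text \<open>The greatest common divisor of the empty set is the polynomial \<open>0\<close>, not a monomial, so
  the empty face is treated separately.\<close>

definition nabla ::
    "('v::finite \<Rightarrow> 'a::comm_monoid_add) \<Rightarrow> 'a \<Rightarrow> 'v monomial set set" where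
  "nabla g m = {F. F \<subseteq> fibre g m \<and> (F = {} \<or> monomial_gcd F \<noteq> 0)}"

text \<open>Vertex sets of the connected components of a simplicial complex.\<close>

definition complex_components :: "'b set set \<Rightarrow> 'b set set" where
  "complex_components K = \<Union>K // {(u, v). {u, v} \<in> K}\<^sup>+"

section \<open>Gluing\<close>

definition only_X :: "('r + 't) monomial \<Rightarrow> bool" where
  "only_X u \<longleftrightarrow> Poly_Mapping.keys u \<subseteq> range Inl"

definition only_Y :: "('r + 't) monomial \<Rightarrow> bool" where
  "only_Y u \<longleftrightarrow> Poly_Mapping.keys u \<subseteq> range Inr"

definition is_pure :: "('r + 't) monomial \<Rightarrow> bool" where
  "is_pure u \<longleftrightarrow> only_X u \<or> only_Y u"

text \<open>The indeterminates \<open>X\<close> are indexed by \<open>'r\<close>, the indeterminates \<open>Y\<close> by \<open>'t\<close>.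
  The sum of ideals is elementwise addition of sets; the ideals of \<open>S\<^sub>1\<close> and \<open>S\<^sub>2\<close> are
  extended to the polynomial ring in all indeterminates.\<close>

definition glued_binomial ::
    "'k::field itself \<Rightarrow> ('r::finite \<Rightarrow> 'a::comm_monoid_add) \<Rightarrow> ('t::finite \<Rightarrow> 'a) \<Rightarrow>
     'r monomial \<Rightarrow> 't monomial \<Rightarrow> bool" where
  "glued_binomial K a b \<gamma>X \<gamma>Y \<longleftrightarrow>
     (let I = (semigroup_ideal (case_sum a b) :: ('r + 't, 'k) mpoly set);
          I1 = (semigroup_ideal a :: ('r, 'k) mpoly set);
          I2 = (semigroup_ideal b :: ('t, 'k) mpoly set);
          f = (monom_poly (push Inl \<gamma>X) - monom_poly (push Inr \<gamma>Y) :: ('r + 't, 'k) mpoly)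
      in f \<noteq> 0 \<and> f \<in> I \<and>
         I = ideal_gen (rename_poly Inl ` I1) + ideal_gen (rename_poly Inr ` I2) + ideal_gen {f})"

definition is_gluing ::
    "'k::field itself \<Rightarrow> ('r::finite \<Rightarrow> 'a::comm_monoid_add) \<Rightarrow> ('t::finite \<Rightarrow> 'a) \<Rightarrow> bool" where
  "is_gluing K a b \<longleftrightarrow> (\<exists>\<gamma>X \<gamma>Y. glued_binomial K a b \<gamma>X \<gamma>Y)"

definition is_glued_degree ::
    "'k::field itself \<Rightarrow> ('r::finite \<Rightarrow> 'a::comm_monoid_add) \<Rightarrow> ('t::finite \<Rightarrow> 'a) \<Rightarrow> 'a \<Rightarrow> bool" where
  "is_glued_degree K a b d \<longleftrightarrow>
     (\<exists>\<gamma>X \<gamma>Y. glued_binomial K a b \<gamma>X \<gamma>Y \<and> d = mdegree a \<gamma>X)"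

definition fibre_X ::
    "('r::finite \<Rightarrow> 'a::comm_monoid_add) \<Rightarrow> ('t::finite \<Rightarrow> 'a) \<Rightarrow> 'a \<Rightarrow> ('r + 't) monomial set" where
  "fibre_X a b m = {u \<in> fibre (case_sum a b) m. only_X u}"

definition fibre_Y ::
    "('r::finite \<Rightarrow> 'a::comm_monoid_add) \<Rightarrow> ('t::finite \<Rightarrow> 'a) \<Rightarrow> 'a \<Rightarrow> ('r + 't) monomial set" where
  "fibre_Y a b m = {u \<in> fibre (case_sum a b) m. only_Y u}"

definition pure_Betti_degree ::
    "'k::field itself \<Rightarrow> ('r::finite \<Rightarrow> 'a::comm_monoid_add) \<Rightarrow> ('t::finite \<Rightarrow> 'a) \<Rightarrow> 'a \<Rightarrow> bool" where
  "pure_Betti_degree K a b d \<longleftrightarrow>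
     d \<in> Betti K (case_sum a b) \<and> fibre_X a b d \<noteq> {} \<and> fibre_Y a b d \<noteq> {} \<and>
     (\<forall>u\<in>fibre (case_sum a b) d. is_pure u)"

section \<open>Adequacy of the encodings\<close>

lemma lookup_push_inj:
  assumes "inj f"
  shows "Poly_Mapping.lookup (push f p) (f x) = Poly_Mapping.lookup p x"
proof -
  have "Poly_Mapping.lookup (push f p) (f x) =
      (\<Sum>y\<in>Poly_Mapping.keys p. if y = x then Poly_Mapping.lookup p y else 0)"
    using assms by (auto simp: push_def lookup_sum lookup_single when_def inj_eq intro!: sum.cong)
  then show ?thesis
    by (simp add: in_keys_iff)
qed

lemma lookup_monomial_gcd:
  "Poly_Mapping.lookup (monomial_gcd F) i = (INF u\<in>F. Poly_Mapping.lookup u i)"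
  by (simp add: monomial_gcd_def)

lemma homogeneous_binomial_iff:
  assumes "u \<noteq> v"
  shows "homogeneous g m (monom_poly u - monom_poly v :: ('v::finite, 'k::field) mpoly) \<longleftrightarrow>
    mdegree g u = m \<and> mdegree g v = m"
proof -
  have "Poly_Mapping.keys (monom_poly u - monom_poly v :: ('v, 'k) mpoly) = {u, v}"
    using assms
    by (auto simp: monom_poly_def in_keys_iff lookup_minus lookup_single when_def split: if_splits)
  then show ?thesis by (simp add: homogeneous_def)
qed

lemma equiv_complex_components:
  assumes "\<And>F G. F \<in> K \<Longrightarrow> G \<subseteq> F \<Longrightarrow> G \<in> K"
  shows "equiv (\<Union>K) ({(u, v). {u, v} \<in> K}\<^sup>+)"
proof (rule equivI)
  let ?R = "{(u, v). {u, v} \<in> K}"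
  have "?R \<subseteq> \<Union>K \<times> \<Union>K" by auto
  then show "?R\<^sup>+ \<subseteq> \<Union>K \<times> \<Union>K" by (rule trancl_subset_Sigma)
  show "refl_on (\<Union>K) (?R\<^sup>+)"
    using assms by (auto simp: refl_on_def intro!: r_into_trancl)
  show "sym (?R\<^sup>+)" by (rule sym_trancl) (auto simp: sym_def insert_commute)
  show "trans (?R\<^sup>+)" by (rule trans_trancl)
qed

end

theory Submission
  imports Defs
begin

text \<open>
  A difference of two monomials lies in a binomial ideal iff the monomials are linked by moves, each
  of which replaces a generator \<open>p\<close> by its partner \<open>q\<close> inside \<open>p + w\<close>. Hence \<open>S\<close> is a gluing iff all
  monomials of equal degree are linked by moves inside \<open>k[X]\<close>, moves inside \<open>k[Y]\<close> and the glued
  move, and a degree is a Betti degree iff its complex of monomials is disconnected.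

  For a gluing, a move leaving a connected component has \<open>w = 0\<close>, hence joins pure monomials; this
  yields condition 1, and applied to a path from a pure \<open>X\<close>- to a pure \<open>Y\<close>-monomial it yields
  condition 2. Condition 3 follows by following the degree of the \<open>X\<close>-part along such a path.
  Conversely, monomials of equal degree are linked by induction on the degree: inside a component one
  divides by common factors, and in a Betti degree one passes to pure monomials, where a
  pure \<open>X\<close>- and a pure \<open>Y\<close>-monomial of degree \<open>k d\<close> are linked through the \<open>k\<close>-th powers of the
  two terms of the glued binomial.
\<close>

section \<open>Maps between polynomial rings\<close>

text \<open>Reduces additive claims to single terms. It serves both levels, since exponent vectors
  and polynomials are both finitely supported maps; the summands in case \<open>add\<close> may
  overlap.\<close>

lemma poly_mapping_induct_single [case_names single add]:
  fixes p :: "'v \<Rightarrow>\<^sub>0 'c::comm_monoid_add"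
  assumes "\<And>x c. P (Poly_Mapping.single x c)" and "\<And>p q. P p \<Longrightarrow> P q \<Longrightarrow> P (p + q)"
  shows "P p"
proof (induction p rule: Poly_Mapping.update_induct)
  case const
  show ?case using assms(1)[of undefined 0] by simp
next
  case (update p x c)
  have "Poly_Mapping.update x c p = p + Poly_Mapping.single x c"
    using update(1)
    by (intro poly_mapping_eqI) (auto simp: lookup_update lookup_add lookup_single when_def in_keys_iff)
  then show ?case using assms update by simp
qed

text \<open>Summing over a set larger than the support puts \<open>p\<close>, \<open>q\<close> and
  \<open>p + q\<close> over one index set, from which additivity of \<open>push\<close>
  follows.\<close>

lemma push_eq_sum:
  assumes "finite A" and "Poly_Mapping.keys p \<subseteq> A"
  shows "push f p = (\<Sum>x\<in>A. Poly_Mapping.single (f x) (Poly_Mapping.lookup p x))"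
  unfolding push_def by (rule sum.mono_neutral_left) (use assms in \<open>auto simp: in_keys_iff\<close>)

lemma push_zero [simp]: "push f 0 = 0"
  by (simp add: push_def)

lemma push_add: "push f (p + q) = push f p + push f q"
proof -
  let ?A = "Poly_Mapping.keys p \<union> Poly_Mapping.keys q"
  have "Poly_Mapping.keys (p + q) \<subseteq> ?A" by (rule Poly_Mapping.keys_add)
  then show ?thesis
    by (simp add: push_eq_sum[of ?A] lookup_add single_add sum.distrib)
qed

lemma push_diff:
  fixes p q :: "'v \<Rightarrow>\<^sub>0 'c::ab_group_add"
  shows "push f (p - q) = push f p - push f q"
  using push_add[of f "p - q" q] by (simp add: algebra_simps)

lemma push_single [simp]: "push f (Poly_Mapping.single x c) = Poly_Mapping.single (f x) c"
  by (simp add: push_def)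

lemma rename_poly_add: "rename_poly f (p + q) = rename_poly f p + rename_poly f q"
  by (simp add: rename_poly_def push_add)

lemma rename_poly_diff: "rename_poly f (p - q) = rename_poly f p - rename_poly f q"
  by (simp add: rename_poly_def push_diff)

lemma rename_poly_monom_poly: "rename_poly f (monom_poly u) = monom_poly (push f u)"
  by (simp add: rename_poly_def monom_poly_def)

lemma rename_poly_mult: "rename_poly f (p * q) = rename_poly f p * rename_poly f q"
proof (induction p rule: poly_mapping_induct_single)
  case (single u c)
  show ?case
    by (induction q rule: poly_mapping_induct_single)
      (simp_all add: rename_poly_def mult_single push_add distrib_left)
qed (simp add: rename_poly_add distrib_right)

section \<open>Binomial ideals\<close>

lemma ideal_gen_base: "x \<in> B \<Longrightarrow> x \<in> ideal_gen B"
  unfolding ideal_gen_def by (rule module.span_base[OF module_times])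

lemma ideal_gen_zero: "0 \<in> ideal_gen B"
  unfolding ideal_gen_def by (rule module.span_zero[OF module_times])

lemma ideal_gen_add: "x \<in> ideal_gen B \<Longrightarrow> y \<in> ideal_gen B \<Longrightarrow> x + y \<in> ideal_gen B"
  unfolding ideal_gen_def by (rule module.span_add[OF module_times])

lemma ideal_gen_neg: "x \<in> ideal_gen B \<Longrightarrow> - x \<in> ideal_gen B"
  unfolding ideal_gen_def by (rule module.span_neg[OF module_times])

lemma ideal_gen_mult: "x \<in> ideal_gen B \<Longrightarrow> c * x \<in> ideal_gen B"
  unfolding ideal_gen_def by (rule module.span_scale[OF module_times])

lemma ideal_gen_induct [consumes 1, case_names zero step]:
  assumes "x \<in> ideal_gen B" and "P 0"
    and "\<And>c x y. x \<in> B \<Longrightarrow> P y \<Longrightarrow> P (c * x + y)"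
  shows "P x"
  using module.span_induct_alt[OF module_times assms(1)[unfolded ideal_gen_def], of P] assms(2,3)
  by blast

lemma ideal_gen_subset:
  assumes "B \<subseteq> ideal_gen C"
  shows "ideal_gen B \<subseteq> ideal_gen C"
proof
  fix x assume "x \<in> ideal_gen B"
  then show "x \<in> ideal_gen C"
    by (induction rule: ideal_gen_induct)
      (use assms in \<open>auto intro: ideal_gen_zero ideal_gen_add ideal_gen_mult\<close>)
qed

lemma ideal_gen_Un: "ideal_gen (B \<union> C) = ideal_gen B + ideal_gen C"
  unfolding ideal_gen_def module.span_Un[OF module_times] by (auto simp: set_plus_def)

text \<open>Renaming is a ring homomorphism, so extending an ideal to the larger ring amounts to
  extending its generators. Applied to the ideals of the two parts in the definition of
  gluing.\<close>

lemma ideal_gen_rename: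
  "ideal_gen (rename_poly f ` ideal_gen B) = ideal_gen (rename_poly f ` B)"
proof
  have "rename_poly f p \<in> ideal_gen (rename_poly f ` B)" if "p \<in> ideal_gen B" for p
    using that
  proof (induction rule: ideal_gen_induct)
    case zero
    show ?case by (simp add: rename_poly_def ideal_gen_zero)
  next
    case (step c x y)
    then show ?case
      by (auto simp: rename_poly_add rename_poly_mult
          intro!: ideal_gen_add ideal_gen_mult intro: ideal_gen_base)
  qed
  then show "ideal_gen (rename_poly f ` ideal_gen B) \<subseteq> ideal_gen (rename_poly f ` B)"
    by (intro ideal_gen_subset) auto
  show "ideal_gen (rename_poly f ` B) \<subseteq> ideal_gen (rename_poly f ` ideal_gen B)"
    by (intro ideal_gen_subset) (auto intro!: ideal_gen_base)
qed

text \<open>Working with pairs of exponent vectors separates the combinatorics from the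
  coefficients.\<close>

definition binomials :: "('v monomial \<times> 'v monomial) set \<Rightarrow> ('v, 'k::comm_ring_1) mpoly set" where
  "binomials P = (\<lambda>(u, v). monom_poly u - monom_poly v) ` P"

definition moves :: "('v monomial \<times> 'v monomial) set \<Rightarrow> ('v monomial \<times> 'v monomial) set" where
  "moves P = {(p + w, q + w) | p q w. (p, q) \<in> P \<or> (q, p) \<in> P}"

text \<open>This is the congruence on the monoid of monomials generated by \<open>P\<close>.\<close>

definition linked :: "('v monomial \<times> 'v monomial) set \<Rightarrow> ('v monomial \<times> 'v monomial) set" where
  "linked P = (moves P)\<^sup>*"

lemma moves_mono: "P \<subseteq> Q \<Longrightarrow> moves P \<subseteq> moves Q"
  by (auto simp: moves_def)

lemma linked_refl: "(u, u) \<in> linked P"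
  by (simp add: linked_def)

lemma linked_trans: "(u, v) \<in> linked P \<Longrightarrow> (v, w) \<in> linked P \<Longrightarrow> (u, w) \<in> linked P"
  unfolding linked_def by (rule rtrancl_trans)

lemma linked_sym: "(u, v) \<in> linked P \<Longrightarrow> (v, u) \<in> linked P"
  using sym_rtrancl[of "moves P"] unfolding linked_def by (auto simp: sym_def moves_def)

lemma movesI: "(p, q) \<in> P \<or> (q, p) \<in> P \<Longrightarrow> (p + w, q + w) \<in> moves P"
  by (auto simp: moves_def)

lemma linked_base: "(u, v) \<in> P \<Longrightarrow> (u, v) \<in> linked P"
  using movesI[of u v P 0] unfolding linked_def by auto

lemma linked_shift: "(u, v) \<in> linked P \<Longrightarrow> (u + w, v + w) \<in> linked P"
  unfolding linked_def
proof (induction rule: rtrancl_induct)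
  case (step v v')
  from step(2) obtain p q w' where "(p, q) \<in> P \<or> (q, p) \<in> P" "v = p + w'" "v' = q + w'"
    by (auto simp: moves_def)
  then have "(v + w, v' + w) \<in> moves P"
    using movesI[of p q P "w' + w"] by (simp add: add.assoc)
  with step(3) show ?case by (rule rtrancl_into_rtrancl)
qed simp

lemma linked_add:
  "(u, v) \<in> linked P \<Longrightarrow> (u', v') \<in> linked P \<Longrightarrow> (u + u', v + v') \<in> linked P"
  using linked_shift[of u v P u'] linked_shift[of u' v' P v] linked_trans
  by (metis add.commute)

text \<open>The polynomials whose coefficients sum to zero over every class of linked monomials form an
  ideal containing the binomials of \<open>P\<close>; this gives the implication from left to right.\<close>

lemma binomial_mem_ideal_iff:
  "(monom_poly u - monom_poly v :: ('v, 'k::comm_ring_1) mpoly) \<in> ideal_gen (binomials P) \<longleftrightarrow>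
    (u, v) \<in> linked P"
proof
  \<comment> \<open>Since \<open>cl u\<close> is the class of \<open>u\<close>, the map
    \<open>push cl\<close> collects the coefficients of a polynomial class by class.\<close>
  define cl where "cl u = linked P `` {u}" for u
  have cl: "cl u = cl v \<longleftrightarrow> (u, v) \<in> linked P" for u v
    unfolding cl_def using linked_refl linked_sym linked_trans by (fast)
  have cl0: "push cl (c * (monom_poly p - monom_poly q)) = 0" if "(p, q) \<in> P"
    for p q and c :: "('v, 'k) mpoly"
  proof (induction c rule: poly_mapping_induct_single)
    case (single w c)
    have "cl (w + p) = cl (w + q)"
      using linked_shift[OF linked_base[OF that], of w] by (simp add: cl add.commute)
    then show ?case by (simp add: monom_poly_def right_diff_distrib mult_single push_diff)
  qed (simp add: distrib_right push_add)
  have "push cl x = 0" if "x \<in> ideal_gen (binomials P)" for x :: "('v, 'k) mpoly"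
    using that
    by (induction rule: ideal_gen_induct) (auto simp: push_add binomials_def cl0)
  moreover assume "(monom_poly u - monom_poly v :: ('v, 'k) mpoly) \<in> ideal_gen (binomials P)"
  ultimately have "push cl (monom_poly u - monom_poly v :: ('v, 'k) mpoly) = 0" by blast
  then have "Poly_Mapping.single (cl u) (1::'k) = Poly_Mapping.single (cl v) 1"
    by (simp add: push_diff monom_poly_def)
  then have "Poly_Mapping.keys (Poly_Mapping.single (cl u) (1::'k)) = Poly_Mapping.keys (Poly_Mapping.single (cl v) (1::'k))"
    by simp
  then show "(u, v) \<in> linked P" by (simp add: cl)
next
  let ?J = "ideal_gen (binomials P) :: ('v, 'k) mpoly set"
  assume "(u, v) \<in> linked P"
  then show "monom_poly u - monom_poly v \<in> ?J"
    unfolding linked_def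
  proof (induction rule: rtrancl_induct)
    case base
    show ?case by (simp add: ideal_gen_zero)
  next
    \<comment> \<open>The differences along a path telescope, and each move contributes a monomial
      times a generator, up to sign.\<close>
    case (step v v')
    from step(2) obtain p q w where pq: "(p, q) \<in> P \<or> (q, p) \<in> P" "v = p + w" "v' = q + w"
      by (auto simp: moves_def)
    have "monom_poly p - monom_poly q \<in> ?J"
      using pq(1)
    proof
      assume "(q, p) \<in> P"
      then have "monom_poly q - monom_poly p \<in> ?J"
        by (auto simp: binomials_def intro!: ideal_gen_base)
      then show ?thesis using ideal_gen_neg by fastforce
    qed (auto simp: binomials_def intro!: ideal_gen_base)
    then have "monom_poly w * (monom_poly p - monom_poly q) \<in> ?J" by (rule ideal_gen_mult)
    then have "monom_poly v - monom_poly v' \<in> ?J"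
      by (simp add: pq monom_poly_def right_diff_distrib mult_single add.commute)
    then show ?case using ideal_gen_add[OF step(3)] by fastforce
  qed
qed

text \<open>Inclusion can be tested on generators, so comparing binomial ideals becomes comparing
  congruences, independently of the coefficients.\<close>

lemma ideal_gen_binomials_subset_iff:
  "(ideal_gen (binomials P) :: ('v, 'k::comm_ring_1) mpoly set) \<subseteq> ideal_gen (binomials Q) \<longleftrightarrow>
    P \<subseteq> linked Q"
proof
  assume *: "(ideal_gen (binomials P) :: ('v, 'k) mpoly set) \<subseteq> ideal_gen (binomials Q)"
  show "P \<subseteq> linked Q"
  proof clarify
    fix u v assume "(u, v) \<in> P"
    then have "(monom_poly u - monom_poly v :: ('v, 'k) mpoly) \<in> ideal_gen (binomials P)"
      by (simp add: binomial_mem_ideal_iff linked_base)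
    with * show "(u, v) \<in> linked Q" by (simp add: binomial_mem_ideal_iff[symmetric, where 'k='k] subset_iff)
  qed
next
  assume "P \<subseteq> linked Q"
  then show "(ideal_gen (binomials P) :: ('v, 'k) mpoly set) \<subseteq> ideal_gen (binomials Q)"
    by (intro ideal_gen_subset)
      (auto simp: binomials_def[of P] binomial_mem_ideal_iff)
qed

section \<open>Degrees of monomials\<close>

lemma multiple_add: "multiple (m + n) x = multiple m x + multiple n x"
  by (induction n) (simp_all add: multiple_def ac_simps)

lemma multiple_0 [simp]: "multiple 0 x = 0"
  by (simp add: multiple_def)

lemma multiple_Suc [simp]: "multiple (Suc n) x = multiple n x + x"
  by (simp add: multiple_def)

lemma mdegree_add [simp]: "mdegree g (u + v) = mdegree g u + mdegree g v"
  by (simp add: mdegree_def lookup_add multiple_add sum.distrib)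

lemma mdegree_zero [simp]: "mdegree g 0 = 0"
  by (simp add: mdegree_def)

lemma mdegree_single [simp]: "mdegree g (Poly_Mapping.single i n) = multiple n (g i)"
proof -
  have "mdegree g (Poly_Mapping.single i n) = (\<Sum>j\<in>UNIV. if j = i then multiple n (g i) else 0)"
    unfolding mdegree_def by (rule sum.cong) (auto simp: lookup_single)
  then show ?thesis by simp
qed

lemma mdegree_multiple: "mdegree g (multiple n u) = multiple n (mdegree g u)"
  by (induction n) simp_all

lemma keys_add_nat: "Poly_Mapping.keys (u + v) = Poly_Mapping.keys u \<union> Poly_Mapping.keys v"
  for u v :: "'v monomial"
  by (auto simp: in_keys_iff lookup_add)

lemma monomial_le_imp_add:
  fixes u v :: "'v monomial"
  assumes "\<And>i. Poly_Mapping.lookup u i \<le> Poly_Mapping.lookup v i"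
  shows "v = u + (v - u)"
  by (rule poly_mapping_eqI) (simp add: lookup_add lookup_minus assms)

lemma share_variable_obtain:
  fixes u v :: "'v monomial"
  assumes "Poly_Mapping.keys u \<inter> Poly_Mapping.keys v \<noteq> {}"
  obtains p q w where "w \<noteq> 0" and "u = p + w" and "v = q + w"
proof -
  from assms obtain i where i: "i \<in> Poly_Mapping.keys u" "i \<in> Poly_Mapping.keys v" by auto
  let ?w = "Poly_Mapping.single i (1::nat)"
  have le: "Poly_Mapping.lookup ?w j \<le> Poly_Mapping.lookup u j"
           "Poly_Mapping.lookup ?w j \<le> Poly_Mapping.lookup v j" for j
    using i by (auto simp: lookup_single when_def in_keys_iff)
  have "?w \<noteq> 0"
    by (metis lookup_single_eq lookup_zero zero_neq_one)
  then show ?thesis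
    using that[of ?w "u - ?w" "v - ?w"] monomial_le_imp_add[OF le(1)] monomial_le_imp_add[OF le(2)]
    by (simp add: add.commute)
qed

section \<open>Dickson's lemma\<close>

lemma nat_seq_incseq_subseq:
  fixes s :: "nat \<Rightarrow> nat"
  obtains r where "strict_mono r" and "incseq (\<lambda>n. s (r n))"
proof -
  obtain r where r: "strict_mono r" "monoseq (\<lambda>n. s (r n))"
    using seq_monosub[of s] by (auto simp: comp_def)
  from r(2) consider "incseq (\<lambda>n. s (r n))" | "decseq (\<lambda>n. s (r n))"
    by (auto simp: monoseq_iff)
  then show ?thesis
  proof cases
    case 1
    with r(1) show ?thesis by (rule that)
  next
    \<comment> \<open>A decreasing sequence of naturals is constant from the index \<open>N\<close>
      on at which it attains its least value.\<close>
    case 2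
    obtain N where N: "s (r N) = (LEAST m. m \<in> range (\<lambda>n. s (r n)))"
      using LeastI[of "\<lambda>m. m \<in> range (\<lambda>n. s (r n))" "s (r 0)"] by auto
    have "s (r (N + n)) = s (r N)" for n
      using decseqD[OF 2, of N "N + n"] Least_le[of "\<lambda>m. m \<in> range (\<lambda>n. s (r n))" "s (r (N + n))"] N
      by auto
    moreover have "strict_mono (\<lambda>n. r (N + n))"
      using r(1) by (auto simp: strict_mono_def)
    ultimately show ?thesis by (intro that[of "\<lambda>n. r (N + n)"]) auto
  qed
qed

text \<open>Passing to a subsequence once per indeterminate makes all exponents nondecreasing; then
  the first term divides the second.\<close>

lemma dickson_lemma:
  fixes u :: "nat \<Rightarrow> 'v::finite monomial"
  obtains i j s where "i < j" and "u j = u i + s"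
proof -
  have "\<exists>r. strict_mono r \<and> (\<forall>x\<in>A. incseq (\<lambda>n. Poly_Mapping.lookup (u (r n)) x))" for A :: "'v set"
  proof (induction A rule: finite_induct[OF finite])
    case 1
    show ?case by (auto intro: exI[of _ id] simp: strict_mono_def)
  next
    case (2 x A)
    then obtain r where r: "strict_mono r" "\<And>x. x \<in> A \<Longrightarrow> incseq (\<lambda>n. Poly_Mapping.lookup (u (r n)) x)"
      by blast
    obtain r' where r': "strict_mono r'" "incseq (\<lambda>n. Poly_Mapping.lookup (u (r (r' n))) x)"
      using nat_seq_incseq_subseq[of "\<lambda>n. Poly_Mapping.lookup (u (r n)) x"] .
    have "incseq (\<lambda>n. Poly_Mapping.lookup (u (r (r' n))) y)" if "y \<in> A" for y
      using r(2)[OF that] r'(1) by (auto simp: mono_def strict_mono_less_eq)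
    moreover have "strict_mono (\<lambda>n. r (r' n))"
      using r(1) r'(1) by (auto simp: strict_mono_def)
    ultimately show ?case using r'(2) by (intro exI[of _ "\<lambda>n. r (r' n)"]) auto
  qed
  from this[of UNIV] obtain r
    where r: "strict_mono r" "\<And>x. incseq (\<lambda>n. Poly_Mapping.lookup (u (r n)) x)" by auto
  have "u (r 1) = u (r 0) + (u (r 1) - u (r 0))"
    by (rule monomial_le_imp_add) (use r(2) in \<open>auto simp: mono_def\<close>)
  moreover have "r 0 < r 1" using r(1) by (simp add: strict_mono_def)
  ultimately show ?thesis by (rule that[rotated])
qed

section \<open>The kernel congruence of the degree map and the semigroup ideal\<close>

definition degree_pairs :: "('v::finite \<Rightarrow> 'a::comm_monoid_add) \<Rightarrow> ('v monomial \<times> 'v monomial) set" where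
  "degree_pairs g = {(u, v). mdegree g u = mdegree g v}"

lemma semigroup_ideal_binomials: "semigroup_ideal g = ideal_gen (binomials (degree_pairs g))"
  unfolding semigroup_ideal_def
  by (rule arg_cong[of _ _ ideal_gen]) (auto simp: binomials_def degree_pairs_def)

lemma linked_mdegree:
  assumes "P \<subseteq> degree_pairs g" and "(u, v) \<in> linked P"
  shows "mdegree g u = mdegree g v"
  using assms(2) unfolding linked_def
proof (induction rule: rtrancl_induct)
  case (step v v')
  from step(2) obtain p q w where "(p, q) \<in> P \<or> (q, p) \<in> P" "v = p + w" "v' = q + w"
    by (auto simp: moves_def)
  moreover from this(1) have "mdegree g p = mdegree g q"
    using assms(1) by (auto simp: degree_pairs_def)
  ultimately show ?case using step(3) by simp
qed simp

lemma linked_degree_pairs: "linked (degree_pairs g) = degree_pairs g"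
proof
  show "linked (degree_pairs g) \<subseteq> degree_pairs g"
  proof clarify
    fix u v assume "(u, v) \<in> linked (degree_pairs g)"
    then have "mdegree g u = mdegree g v" by (rule linked_mdegree[OF subset_refl])
    then show "(u, v) \<in> degree_pairs g" by (simp add: degree_pairs_def)
  qed
  show "degree_pairs g \<subseteq> linked (degree_pairs g)"
    by (auto intro: linked_base)
qed

text \<open>One inclusion of ideals is the hypothesis, because \<open>degree_pairs g\<close> is
  already a congruence; only the other one remains to be tested.\<close>

lemma ideal_gen_binomials_eq_semigroup_ideal_iff:
  assumes "P \<subseteq> degree_pairs g"
  shows "(ideal_gen (binomials P) :: ('v::finite, 'k::field) mpoly set) = semigroup_ideal g \<longleftrightarrow>
    degree_pairs g \<subseteq> linked P"
  by (simp add: semigroup_ideal_binomials set_eq_subset ideal_gen_binomials_subset_iff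
      linked_degree_pairs assms)

section \<open>Connected components of the complexes of monomials\<close>

definition adjacent :: "('v::finite \<Rightarrow> 'a::comm_monoid_add) \<Rightarrow> ('v monomial \<times> 'v monomial) set" where
  "adjacent g = {(u, v). mdegree g u = mdegree g v \<and> Poly_Mapping.keys u \<inter> Poly_Mapping.keys v \<noteq> {}}"

text \<open>One relation serves the complexes of all degrees. It also relates the monomial
  \<open>0\<close> to itself, although that monomial is a vertex of no complex.\<close>

definition conn :: "('v::finite \<Rightarrow> 'a::comm_monoid_add) \<Rightarrow> ('v monomial \<times> 'v monomial) set" where
  "conn g = (adjacent g)\<^sup>*"

lemma conn_refl: "(u, u) \<in> conn g"
  by (simp add: conn_def)

lemma conn_trans: "(u, v) \<in> conn g \<Longrightarrow> (v, w) \<in> conn g \<Longrightarrow> (u, w) \<in> conn g"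
  unfolding conn_def by (rule rtrancl_trans)

lemma conn_sym: "(u, v) \<in> conn g \<Longrightarrow> (v, u) \<in> conn g"
  using sym_rtrancl[of "adjacent g"] unfolding conn_def by (auto simp: sym_def adjacent_def)

lemma conn_mdegree: "(u, v) \<in> conn g \<Longrightarrow> mdegree g u = mdegree g v"
  unfolding conn_def by (induction rule: rtrancl_induct) (auto simp: adjacent_def)

lemma conn_add:
  assumes "mdegree g p = mdegree g q" and "w \<noteq> 0"
  shows "(p + w, q + w) \<in> conn g"
proof -
  obtain i where "i \<in> Poly_Mapping.keys w" using assms(2) by (metis all_not_in_conv keys_eq_empty)
  then have "(p + w, q + w) \<in> adjacent g"
    using assms(1) by (auto simp: adjacent_def keys_add_nat)
  then show ?thesis by (simp add: conn_def)
qed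

text \<open>Components depend on the edges only, and the exponents of the gcd of two monomials are
  the minima of theirs. The case \<open>u = v\<close> is included.\<close>

lemma nabla_pair: "{u, v} \<in> nabla g m \<longleftrightarrow>
    mdegree g u = m \<and> mdegree g v = m \<and> Poly_Mapping.keys u \<inter> Poly_Mapping.keys v \<noteq> {}"
proof -
  have "Poly_Mapping.lookup (monomial_gcd {u, v}) i =
      min (Poly_Mapping.lookup u i) (Poly_Mapping.lookup v i)" for i
    by (simp add: lookup_monomial_gcd cInf_eq_Min)
  then have "monomial_gcd {u, v} = 0 \<longleftrightarrow> Poly_Mapping.keys u \<inter> Poly_Mapping.keys v = {}"
    by (auto simp: poly_mapping_eq_iff fun_eq_iff in_keys_iff min_def disjoint_iff)
  then show ?thesis by (auto simp: nabla_def fibre_def)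
qed

lemma Union_nabla: "\<Union>(nabla g m) = {u. mdegree g u = m \<and> u \<noteq> 0}"
proof
  \<comment> \<open>A face containing the monomial 1 would have gcd 1.\<close>
  have "u \<noteq> 0" if "F \<in> nabla g m" "u \<in> F" for F u
  proof
    assume "u = 0"
    have "Poly_Mapping.lookup (monomial_gcd F) i \<le> Poly_Mapping.lookup u i" for i
      unfolding lookup_monomial_gcd by (rule cINF_lower) (use that in auto)
    then have "monomial_gcd F = 0"
      by (intro poly_mapping_eqI) (use \<open>u = 0\<close> in auto)
    with that show False by (auto simp: nabla_def)
  qed
  then show "\<Union>(nabla g m) \<subseteq> {u. mdegree g u = m \<and> u \<noteq> 0}"
    by (auto simp: nabla_def fibre_def)
  show "{u. mdegree g u = m \<and> u \<noteq> 0} \<subseteq> \<Union>(nabla g m)"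
  proof clarify
    fix u :: "'a monomial" assume "u \<noteq> 0"
    then have "{u, u} \<in> nabla g (mdegree g u)" by (simp only: nabla_pair) simp
    then show "u \<in> \<Union>(nabla g (mdegree g u))" by auto
  qed
qed

text \<open>Components are defined by a transitive closure, \<open>conn\<close> by a reflexive one.
  They agree at a nonzero monomial because it forms an edge with itself.\<close>

lemma complex_components_nabla:
  "complex_components (nabla g m) = {conn g `` {u} | u. mdegree g u = m \<and> u \<noteq> 0}"
proof -
  let ?R = "{(u, v). {u, v} \<in> nabla g m}"
  have "(u, v) \<in> ?R\<^sup>+ \<longleftrightarrow> (u, v) \<in> conn g" if u: "mdegree g u = m" "u \<noteq> 0" for u v
  proof
    assume "(u, v) \<in> ?R\<^sup>+"
    moreover have "?R \<subseteq> adjacent g" by (auto simp: nabla_pair adjacent_def)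
    ultimately show "(u, v) \<in> conn g"
      unfolding conn_def by (intro trancl_into_rtrancl) (rule trancl_mono)
  next
    assume "(u, v) \<in> conn g"
    then have "(u, v) \<in> ?R\<^sup>+ \<and> mdegree g v = m"
      unfolding conn_def
    proof (induction rule: rtrancl_induct)
      case base
      have "{u, u} \<in> nabla g m" unfolding nabla_pair using u by simp
      then have "(u, u) \<in> ?R\<^sup>+" by (intro r_into_trancl) simp
      then show ?case using u by simp
    next
      case (step v v')
      have "mdegree g v' = mdegree g v" "Poly_Mapping.keys v \<inter> Poly_Mapping.keys v' \<noteq> {}"
        using step(2) by (simp_all add: adjacent_def)
      with conjunct2[OF step.IH] have "(v, v') \<in> ?R" "mdegree g v' = m"
        by (simp_all add: nabla_pair)
      then show ?case using trancl_into_trancl[OF conjunct1[OF step.IH]] by simp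
    qed
    then show "(u, v) \<in> ?R\<^sup>+" ..
  qed
  then have "?R\<^sup>+ `` {u} = conn g `` {u}" if "mdegree g u = m" "u \<noteq> 0" for u
    using that by blast
  then show ?thesis
    unfolding complex_components_def quotient_def Union_nabla by blast
qed

section \<open>Betti degrees\<close>

text \<open>This is what the semigroup hypotheses amount to on degrees of monomials: degrees cancel,
  and only the monomial 1 has degree 0.\<close>

locale positive_grading =
  fixes g :: "'v::finite \<Rightarrow> 'a::comm_monoid_add"
  assumes cancel: "mdegree g (u + w) = mdegree g (v + w) \<Longrightarrow> mdegree g u = mdegree g v"
    and pointed: "mdegree g u = 0 \<Longrightarrow> u = 0"
begin

lemma add_eq_zero_iff: "mdegree g (u + w) = mdegree g u \<Longrightarrow> w = 0"
  using cancel[of w u 0] pointed by (simp add: add.commute)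

text \<open>The strict order of the semigroup, in which one degree exceeds another by the degree of
  a nontrivial monomial, carried over to monomials.\<close>

definition below :: "('v monomial \<times> 'v monomial) set" where
  "below = {(u, v). \<exists>w. w \<noteq> 0 \<and> mdegree g (u + w) = mdegree g v}"

lemma below_cong: "(u, v) \<in> below \<Longrightarrow> mdegree g v = mdegree g v' \<Longrightarrow> (u, v') \<in> below"
  by (simp add: below_def)

lemma trans_below: "trans below"
proof (rule transI)
  fix u v z assume "(u, v) \<in> below" "(v, z) \<in> below"
  then obtain w w' where "w \<noteq> 0" "mdegree g (u + w) = mdegree g v" "mdegree g (v + w') = mdegree g z"
    by (auto simp: below_def)
  then have "mdegree g (u + (w + w')) = mdegree g z" by (simp flip: add.assoc)
  moreover have "w + w' \<noteq> 0"
    using \<open>w \<noteq> 0\<close> keys_add_nat[of w w'] by (metis keys_eq_empty sup_eq_bot_iff)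
  ultimately show "(u, z) \<in> below" unfolding below_def by blast
qed

text \<open>In an infinite descending chain, Dickson's lemma yields a later term that is a multiple
  of an earlier one, although its degree is strictly smaller. A nontrivial monomial would then have
  degree 0.\<close>

lemma wf_below: "wf below"
  unfolding wf_iff_no_infinite_down_chain
proof
  assume "\<exists>u. \<forall>i. (u (Suc i), u i) \<in> below"
  then obtain u where u: "\<And>i. (u (Suc i), u i) \<in> below" by blast
  obtain i j s where ij: "i < j" "u j = u i + s" by (rule dickson_lemma)
  have "(u j, u i) \<in> below"
    using ij(1)
  proof (induction j rule: less_Suc_induct)
    case (1 i)
    show ?case by (rule u)
  next
    case (2 i j k)
    then show ?case using trans_below by (blast dest: transD)
  qed
  then obtain w where "w \<noteq> 0" "mdegree g (u i + (s + w)) = mdegree g (u i)"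
    by (auto simp: below_def ij(2) add.assoc)
  then have "s + w = 0" by (intro add_eq_zero_iff)
  then show False
    using \<open>w \<noteq> 0\<close> keys_add_nat[of s w] by (metis keys_eq_empty sup_eq_bot_iff)
qed

text \<open>Dividing adjacent monomials by a common factor leaves quotients of equal, strictly
  smaller degree. These are linked by assumption, and multiplying back links the monomials
  themselves.\<close>

lemma conn_imp_linked:
  assumes "(u, v) \<in> conn g"
    and "\<And>p q. (p, u) \<in> below \<Longrightarrow> mdegree g p = mdegree g q \<Longrightarrow> (p, q) \<in> linked P"
  shows "(u, v) \<in> linked P"
  using assms(1) unfolding conn_def
proof (induction rule: rtrancl_induct)
  case base
  show ?case by (rule linked_refl)
next
  case (step v v')
  from step(2) obtain p q w where *: "w \<noteq> 0" "v = p + w" "v' = q + w"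
    by (auto simp: adjacent_def elim!: share_variable_obtain)
  have "mdegree g v = mdegree g v'" using step(2) by (simp add: adjacent_def)
  with * have "mdegree g p = mdegree g q" by (auto intro: cancel)
  moreover have "mdegree g u = mdegree g v"
    using step(1) by (auto intro: conn_mdegree simp: conn_def)
  then have "(p, u) \<in> below" using * by (auto simp: below_def)
  ultimately have "(p + w, q + w) \<in> linked P" by (intro linked_shift assms(2))
  then show ?case using step(3) * linked_trans by blast
qed

text \<open>The degree is constant along a path, and the side of a pair used in a move divides the
  monomial it acts on.\<close>

lemma linked_imp_linked_divisors:
  assumes "P \<subseteq> degree_pairs g" and "(u, v) \<in> linked P"
  shows "(u, v) \<in> linked {(p, q) \<in> P. \<exists>w. mdegree g (p + w) = mdegree g u}" (is "_ \<in> linked ?Q")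
  using assms(2) unfolding linked_def[of P]
proof (induction rule: rtrancl_induct)
  case base
  show ?case by (rule linked_refl)
next
  case (step v v')
  have eq: "mdegree g u = mdegree g v" "mdegree g u = mdegree g v'"
    using linked_mdegree[OF assms(1)] step(1,2) unfolding linked_def
    by (auto intro: rtrancl_into_rtrancl)
  from step(2) obtain p q w where *: "(p, q) \<in> P \<or> (q, p) \<in> P" "v = p + w" "v' = q + w"
    by (auto simp: moves_def)
  then have "(p, q) \<in> ?Q \<or> (q, p) \<in> ?Q" using eq by auto
  then have "(v, v') \<in> linked ?Q"
    using * by (auto intro: linked_shift linked_base linked_sym)
  then show ?case using step(3) linked_trans by blast
qed

text \<open>If the two terms of a generator \<open>f\<close> lay in one component, they would be
  linked through generators of smaller degree, hence without \<open>f\<close>, against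
  minimality.\<close>

lemma Betti_imp_disconnected:
  assumes "m \<in> Betti TYPE('k::field) g"
  shows "\<exists>u v. mdegree g u = m \<and> mdegree g v = m \<and> (u, v) \<notin> conn g"
proof -
  from assms obtain B :: "('v, 'k) mpoly set" and f
    where B: "minimal_binomial_generators g B" and f: "f \<in> B" "homogeneous g m f"
    by (auto simp: Betti_def)
  \<comment> \<open>Translates a generating set of polynomials back into pairs, so that linkage can
    be applied to it.\<close>
  define pairs where "pairs B = {(p, q). p \<noteq> q \<and> monom_poly p - monom_poly q \<in> B}"
    for B :: "('v, 'k) mpoly set"
  have pairs: "binomials (pairs B') = B'" "pairs B' \<subseteq> degree_pairs g" if "B' \<subseteq> B" for B'
  proof -
    have *: "is_binomial f \<and> (\<exists>m. homogeneous g m f)" if "f \<in> B'" for f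
      using B that \<open>B' \<subseteq> B\<close> by (auto simp: minimal_binomial_generators_def)
    then show "binomials (pairs B') = B'"
      by (auto simp: binomials_def pairs_def is_binomial_def image_iff) metis
    show "pairs B' \<subseteq> degree_pairs g"
      using * by (auto simp: pairs_def degree_pairs_def) (metis homogeneous_binomial_iff)
  qed
  from B f obtain u v where uv: "u \<noteq> v" "f = monom_poly u - monom_poly v"
    by (auto simp: minimal_binomial_generators_def is_binomial_def)
  with f have deg: "mdegree g u = m" "mdegree g v = m" by (auto simp: homogeneous_binomial_iff)
  have "(u, v) \<notin> conn g"
  proof
    assume conn: "(u, v) \<in> conn g"
    let ?P = "pairs (B - {f})"
    have all: "degree_pairs g \<subseteq> linked (pairs B)"
      using B ideal_gen_binomials_eq_semigroup_ideal_iff[OF pairs(2)[of B], where 'k='k]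
      by (simp add: pairs minimal_binomial_generators_def)
    have "(u, v) \<in> linked ?P"
    proof (rule conn_imp_linked[OF conn])
      fix p q assume pq: "(p, u) \<in> below" "mdegree g p = mdegree g q"
      let ?Q = "{(a, b) \<in> pairs B. \<exists>w. mdegree g (a + w) = mdegree g p}"
      have "(p, q) \<in> linked (pairs B)" using all pq(2) by (auto simp: degree_pairs_def)
      then have "(p, q) \<in> linked ?Q"
        by (rule linked_imp_linked_divisors[OF pairs(2), rotated]) simp
      \<comment> \<open>A generator whose degree divides that of \<open>p\<close> is not
        \<open>f\<close>: the degree of \<open>p\<close> is strictly below \<open>m\<close>.\<close>
      moreover have "?Q \<subseteq> ?P"
      proof clarify
        fix a b w assume ab: "(a, b) \<in> pairs B" and w: "mdegree g (a + w) = mdegree g p"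
        from pq(1) obtain w' where w': "w' \<noteq> 0" "mdegree g (p + w') = mdegree g u"
          by (auto simp: below_def)
        have "monom_poly a - monom_poly b \<noteq> f"
        proof
          assume "monom_poly a - monom_poly b = f"
          then have "mdegree g a = m" using ab f(2) by (auto simp: pairs_def homogeneous_binomial_iff)
          then have "mdegree g (a + (w + w')) = mdegree g a"
            using w w'(2) deg(1) by (simp flip: add.assoc)
          then have "w + w' = 0" by (rule add_eq_zero_iff)
          then show False
            using \<open>w' \<noteq> 0\<close> keys_add_nat[of w w'] by (metis keys_eq_empty sup_eq_bot_iff)
        qed
        then show "(a, b) \<in> ?P" using ab by (auto simp: pairs_def)
      qed
      ultimately show "(p, q) \<in> linked ?P"
        unfolding linked_def by (meson moves_mono rtrancl_mono subsetD)
    qed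
    then have "f \<in> ideal_gen (B - {f})"
      using binomial_mem_ideal_iff[of u v ?P, where 'k='k] by (simp add: uv pairs)
    then have "ideal_gen B \<subseteq> ideal_gen (B - {f})"
      by (intro ideal_gen_subset) (auto intro: ideal_gen_base)
    moreover have "ideal_gen (B - {f}) \<subseteq> ideal_gen B"
      by (intro ideal_gen_subset) (auto intro: ideal_gen_base)
    ultimately show False
      using B f(1) unfolding minimal_binomial_generators_def by blast
  qed
  with deg show ?thesis by blast
qed

text \<open>A minimal generating set is obtained by joining, in every degree, one monomial of each
  connected component to that of a fixed component.\<close>

lemma disconnected_imp_Betti:
  assumes "mdegree g u = m" and "mdegree g v = m" and "(u, v) \<notin> conn g"
  shows "m \<in> Betti TYPE('k::field) g"
proof -
  \<comment> \<open>Both choices depend only on a class: \<open>rep u\<close> on the component of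
    \<open>u\<close>, \<open>root u\<close> on its degree.\<close>
  define rep where "rep u = (SOME v. (u, v) \<in> conn g)" for u
  define root where "root u = rep (SOME v. mdegree g v = mdegree g u)" for u
  have rep: "(u, rep u) \<in> conn g" for u
    unfolding rep_def by (rule someI[of _ u]) (rule conn_refl)
  have "mdegree g (SOME v. mdegree g v = mdegree g u) = mdegree g u" for u
    by (rule someI[of _ u]) simp
  then have deg [simp]: "mdegree g (rep u) = mdegree g u" "mdegree g (root u) = mdegree g u" for u
    using conn_mdegree[OF rep] by (auto simp: root_def)
  have rep_cong: "rep u = rep v" if "(u, v) \<in> conn g" for u v
    unfolding rep_def using that by (metis conn_sym conn_trans)
  have root_cong: "root u = root v" if "mdegree g u = mdegree g v" for u v
    using that by (simp add: root_def)
  have rep_idem: "rep (rep u) = rep u" "rep (root u) = root u" for u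
    using rep_cong[OF rep] by (auto simp: root_def)
  \<comment> \<open>One pair for each component other than that of the root; excluding
    \<open>rep u = root u\<close> keeps the zero binomial out.\<close>
  define P where "P = {(rep u, root u) | u. rep u \<noteq> root u}"
  have P: "P \<subseteq> degree_pairs g" by (auto simp: P_def degree_pairs_def)
  let ?B = "binomials P :: ('v, 'k) mpoly set"
  have linked: "(u, v) \<in> linked P" if "mdegree g u = mdegree g v" for u v
    using wf_below that
  proof (induction u arbitrary: v rule: wf_induct_rule)
    case (less u)
    \<comment> \<open>The path runs inside the component to \<open>rep z\<close>, by induction on
      the degree, and then uses at most one generator.\<close>
    have *: "(z, root z) \<in> linked P" if "mdegree g u = mdegree g z" for z
    proof -
      have "(z, rep z) \<in> linked P"
        by (rule conn_imp_linked[OF rep])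
          (use less.IH below_cong that in \<open>metis\<close>)
      moreover have "(rep z, root z) \<in> linked P"
        by (cases "rep z = root z") (auto simp: P_def intro: linked_refl linked_base)
      ultimately show ?thesis by (rule linked_trans)
    qed
    show ?case
      using *[of u] *[of v] less.prems root_cong[of u v] by (metis linked_sym linked_trans)
  qed
  have min: "ideal_gen B' \<noteq> semigroup_ideal g" if "B' \<subset> ?B" for B'
  proof
    assume gen: "ideal_gen B' = semigroup_ideal g"
    from that obtain u where u: "rep u \<noteq> root u" "monom_poly (rep u) - monom_poly (root u) \<notin> B'"
      by (auto simp: binomials_def P_def)
    define P' where "P' = {(p, q) \<in> P. monom_poly p - monom_poly q \<in> B'}"
    have "binomials P' = B'" using that by (auto simp: binomials_def P'_def)
    moreover have "P' \<subseteq> degree_pairs g" using P by (auto simp: P'_def)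
    ultimately have "degree_pairs g \<subseteq> linked P'"
      using gen ideal_gen_binomials_eq_semigroup_ideal_iff[of P' g, where 'k='k] by simp
    then have "(rep u, root u) \<in> linked P'" by (auto simp: degree_pairs_def)
    \<comment> \<open>Without the pair of \<open>u\<close>, no move can leave the component of
      \<open>rep u\<close>, although the root lies in another one.\<close>
    then have "(rep u, root u) \<in> conn g"
      unfolding linked_def
    proof (induction rule: rtrancl_induct)
      case base
      show ?case by (rule conn_refl)
    next
      case (step v v')
      from step(2) obtain p q w where *: "(p, q) \<in> P' \<or> (q, p) \<in> P'" "v = p + w" "v' = q + w"
        by (auto simp: moves_def)
      have repv: "rep v = rep u" using rep_cong[OF step(3)] rep_idem by simp
      have rootv: "root v = root u" using root_cong[of v "rep u"] root_cong[of "rep u" u] conn_mdegree[OF step(3)] by simp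
      \<comment> \<open>A move without cofactor is a pair of \<open>P'\<close> itself. If
        \<open>v\<close> is its \<open>rep\<close> side, it is the removed pair; if \<open>v\<close>
        is its \<open>root\<close> side, then \<open>rep u = root u\<close>.\<close>
      have "w \<noteq> 0"
      proof
        assume "w = 0"
        with * have "(v, v') \<in> P' \<or> (v', v) \<in> P'" by simp
        then show False
        proof
          assume "(v, v') \<in> P'"
          then obtain z where z: "v = rep z" "v' = root z" "monom_poly v - monom_poly v' \<in> B'"
            unfolding P'_def P_def by blast
          then have "v = rep u" using repv rep_idem(1)[of z] by simp
          moreover have "root z = root u" using rootv z(1) root_cong[of "rep z" z] by simp
          ultimately show False using u(2) z by simp
        next
          assume "(v', v) \<in> P'"
          then obtain z where z: "v = root z" unfolding P'_def P_def by blast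
          then have "root z = root u" using rootv root_cong[of "root z" z] by simp
          then show False using u(1) repv z rep_idem(2)[of z] by simp
        qed
      qed
      moreover have "mdegree g p = mdegree g q"
        using *(1) P by (auto simp: P'_def degree_pairs_def)
      ultimately have "(v, v') \<in> conn g" unfolding * by (intro conn_add)
      with step(3) show ?case by (rule conn_trans)
    qed
    then show False using u(1) rep_cong rep_idem by metis
  qed
  have "minimal_binomial_generators g ?B"
    unfolding minimal_binomial_generators_def
  proof (intro conjI ballI allI impI)
    fix f assume "f \<in> ?B"
    then obtain p q where "(p, q) \<in> P" and f: "f = monom_poly p - monom_poly q"
      unfolding binomials_def by (elim imageE) auto
    then obtain u where u: "rep u \<noteq> root u" "p = rep u" "q = root u"
      unfolding P_def by blast
    show "is_binomial f" unfolding is_binomial_def by (intro exI[of _ p] exI[of _ q]) (simp add: f u)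
    show "\<exists>m. homogeneous g m f"
      by (rule exI[of _ "mdegree g u"]) (simp add: f u homogeneous_binomial_iff)
  next
    show "ideal_gen ?B = semigroup_ideal g"
      using linked by (auto simp: ideal_gen_binomials_eq_semigroup_ideal_iff[OF P] degree_pairs_def)
  qed (rule min)
  moreover have "rep u \<noteq> rep v"
    using assms(3) rep conn_sym conn_trans by metis
  \<comment> \<open>Of two distinct components of one degree, at most one contains the root.\<close>
  then have "rep u \<noteq> root u \<or> rep v \<noteq> root v"
    using root_cong[of u v] assms by auto
  then obtain z where z: "mdegree g z = m" "rep z \<noteq> root z" using assms by blast
  then have "(rep z, root z) \<in> P" unfolding P_def by blast
  then have "monom_poly (rep z) - monom_poly (root z) \<in> ?B"
    unfolding binomials_def by (rule rev_image_eqI) simp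
  moreover have "homogeneous g m (monom_poly (rep z) - monom_poly (root z) :: ('v, 'k) mpoly)"
    using z by (simp add: homogeneous_binomial_iff)
  ultimately show ?thesis unfolding Betti_def by blast
qed

lemma Betti_iff:
  "m \<in> Betti TYPE('k::field) g \<longleftrightarrow> (\<exists>u v. mdegree g u = m \<and> mdegree g v = m \<and> (u, v) \<notin> conn g)"
  using Betti_imp_disconnected disconnected_imp_Betti by blast

lemma zero_notin_Betti: "0 \<notin> Betti TYPE('k::field) g"
  using pointed conn_refl unfolding Betti_iff by metis

end

section \<open>Gluing\<close>

lemma lookup_push_notin_range:
  assumes "y \<notin> range f"
  shows "Poly_Mapping.lookup (push f p) y = 0"
  using assms by (auto simp: push_def lookup_sum lookup_single when_def intro!: sum.neutral)

lemma lookup_push_Inl_Inr [simp]: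
  "Poly_Mapping.lookup (push Inl x) (Inl i) = Poly_Mapping.lookup x i"
  "Poly_Mapping.lookup (push Inl x) (Inr j) = 0"
  "Poly_Mapping.lookup (push Inr y) (Inr j) = Poly_Mapping.lookup y j"
  "Poly_Mapping.lookup (push Inr y) (Inl i) = 0"
  by (auto simp: lookup_push_inj intro!: lookup_push_notin_range)

lemma mdegree_push_Inl [simp]: "mdegree (case_sum a b) (push Inl x) = mdegree a x"
proof -
  have "mdegree (case_sum a b) (push Inl x) =
      (\<Sum>i\<in>UNIV <+> UNIV. multiple (Poly_Mapping.lookup (push Inl x) i) (case_sum a b i))"
    by (simp add: mdegree_def)
  then show ?thesis by (simp add: sum.Plus mdegree_def del: UNIV_Plus_UNIV)
qed

lemma mdegree_push_Inr [simp]: "mdegree (case_sum a b) (push Inr y) = mdegree b y"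
proof -
  have "mdegree (case_sum a b) (push Inr y) =
      (\<Sum>i\<in>UNIV <+> UNIV. multiple (Poly_Mapping.lookup (push Inr y) i) (case_sum a b i))"
    by (simp add: mdegree_def)
  then show ?thesis by (simp add: sum.Plus mdegree_def del: UNIV_Plus_UNIV)
qed

section \<open>Pure monomials and the two parts of a monomial\<close>

definition part_X :: "('r + 't) monomial \<Rightarrow> 'r monomial" where
  "part_X = Poly_Mapping.map_key Inl"

definition part_Y :: "('r + 't) monomial \<Rightarrow> 't monomial" where
  "part_Y = Poly_Mapping.map_key Inr"

lemma lookup_part [simp]:
  "Poly_Mapping.lookup (part_X u) i = Poly_Mapping.lookup u (Inl i)"
  "Poly_Mapping.lookup (part_Y u) j = Poly_Mapping.lookup u (Inr j)"
  by (simp_all add: part_X_def part_Y_def map_key.rep_eq)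

lemma part_X_add [simp]: "part_X (u + v) = part_X u + part_X v"
  by (rule poly_mapping_eqI) (simp add: lookup_add)

lemma part_X_push [simp]: "part_X (push Inl x) = x" "part_X (push Inr y) = 0"
  by (auto intro!: poly_mapping_eqI)

lemma only_X_iff: "only_X u \<longleftrightarrow> (\<forall>j. Poly_Mapping.lookup u (Inr j) = 0)"
proof
  assume "only_X u"
  then show "\<forall>j. Poly_Mapping.lookup u (Inr j) = 0"
    unfolding only_X_def by (metis Inl_Inr_False in_keys_iff rangeE subsetD)
next
  assume *: "\<forall>j. Poly_Mapping.lookup u (Inr j) = 0"
  have "k \<in> range Inl" if "k \<in> Poly_Mapping.keys u" for k
    using that * by (cases k) (simp_all add: in_keys_iff)
  then show "only_X u" unfolding only_X_def by blast
qed

lemma only_Y_iff: "only_Y u \<longleftrightarrow> (\<forall>i. Poly_Mapping.lookup u (Inl i) = 0)"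
proof
  assume "only_Y u"
  then show "\<forall>i. Poly_Mapping.lookup u (Inl i) = 0"
    unfolding only_Y_def by (metis Inl_Inr_False in_keys_iff rangeE subsetD)
next
  assume *: "\<forall>i. Poly_Mapping.lookup u (Inl i) = 0"
  have "k \<in> range Inr" if "k \<in> Poly_Mapping.keys u" for k
    using that * by (cases k) (simp_all add: in_keys_iff)
  then show "only_Y u" unfolding only_Y_def by blast
qed

lemma sum_monomial_eqI:
  assumes "\<And>i. Poly_Mapping.lookup u (Inl i) = Poly_Mapping.lookup v (Inl i)"
    and "\<And>j. Poly_Mapping.lookup u (Inr j) = Poly_Mapping.lookup v (Inr j)"
  shows "u = v"
proof (rule poly_mapping_eqI)
  fix k show "Poly_Mapping.lookup u k = Poly_Mapping.lookup v k"
    using assms by (cases k) auto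
qed

lemma only_X_push [simp]: "only_X (push Inl x)"
  by (simp add: only_X_iff)

lemma only_Y_push [simp]: "only_Y (push Inr y)"
  by (simp add: only_Y_iff)

lemma only_Y_push_Inl [simp]: "only_Y (push Inl x) \<longleftrightarrow> x = 0"
  by (auto simp: only_Y_iff intro: poly_mapping_eqI)

lemma only_X_push_Inr [simp]: "only_X (push Inr y) \<longleftrightarrow> y = 0"
  by (auto simp: only_X_iff intro: poly_mapping_eqI)

lemma only_X_eq: "only_X u \<Longrightarrow> push Inl (part_X u) = u"
  by (rule sum_monomial_eqI) (simp_all add: only_X_iff)

lemma only_Y_eq: "only_Y u \<Longrightarrow> push Inr (part_Y u) = u"
  by (rule sum_monomial_eqI) (simp_all add: only_Y_iff)

lemma only_X_Y_zero: "only_X u \<Longrightarrow> only_Y u \<Longrightarrow> u = 0"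
  by (rule sum_monomial_eqI) (simp_all add: only_X_iff only_Y_iff)

lemma only_X_add: "only_X (u + v) \<longleftrightarrow> only_X u \<and> only_X v"
  by (auto simp: only_X_iff lookup_add)

lemma only_Y_add: "only_Y (u + v) \<longleftrightarrow> only_Y u \<and> only_Y v"
  by (auto simp: only_Y_iff lookup_add)

text \<open>The shared indeterminate is an \<open>X\<close>, which decides the kind of the pure
  monomial \<open>v\<close>.\<close>

lemma only_X_share:
  assumes "only_X u" and "is_pure v" and "Poly_Mapping.keys u \<inter> Poly_Mapping.keys v \<noteq> {}"
  shows "only_X v"
proof -
  obtain k where "k \<in> Poly_Mapping.keys u" "k \<in> Poly_Mapping.keys v" using assms(3) by blast
  with assms(1) have "\<not> only_Y v" unfolding only_X_def only_Y_def by (metis Inl_Inr_False rangeE subsetD)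
  with assms(2) show ?thesis by (simp add: is_pure_def)
qed

section \<open>The congruence belonging to a gluing\<close>

definition gluing_pairs ::
    "('r::finite \<Rightarrow> 'a::comm_monoid_add) \<Rightarrow> ('t::finite \<Rightarrow> 'a) \<Rightarrow> 'r monomial \<Rightarrow> 't monomial \<Rightarrow>
     (('r + 't) monomial \<times> ('r + 't) monomial) set" where
  "gluing_pairs a b \<gamma>X \<gamma>Y =
     map_prod (push Inl) (push Inl) ` degree_pairs a \<union>
     map_prod (push Inr) (push Inr) ` degree_pairs b \<union> {(push Inl \<gamma>X, push Inr \<gamma>Y)}"

lemma rename_poly_binomials:
  "rename_poly f ` binomials P = binomials (map_prod (push f) (push f) ` P)"
  by (force simp: binomials_def image_image rename_poly_diff rename_poly_monom_poly split: prod.splits)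

lemma binomials_Un: "binomials (P \<union> Q) = binomials P \<union> binomials Q"
  by (simp add: binomials_def image_Un)

lemma monom_poly_eq_iff [simp]:
  "(monom_poly u :: ('v, 'k::comm_ring_1) mpoly) = monom_poly v \<longleftrightarrow> u = v"
proof
  assume "(monom_poly u :: ('v, 'k) mpoly) = monom_poly v"
  then have "Poly_Mapping.keys (monom_poly u :: ('v, 'k) mpoly) = Poly_Mapping.keys (monom_poly v :: ('v, 'k) mpoly)"
    by simp
  then show "u = v" by (simp add: monom_poly_def)
qed simp

text \<open>The sum of ideals in the definition is the binomial ideal of
  \<open>gluing_pairs\<close>, so gluing becomes a statement about linkage from which the field has
  disappeared.\<close>

lemma glued_binomial_iff:
  "glued_binomial TYPE('k::field) a b \<gamma>X \<gamma>Y \<longleftrightarrow>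
    push Inl \<gamma>X \<noteq> push Inr \<gamma>Y \<and> mdegree a \<gamma>X = mdegree b \<gamma>Y \<and>
    degree_pairs (case_sum a b) \<subseteq> linked (gluing_pairs a b \<gamma>X \<gamma>Y)"
proof -
  let ?I = "semigroup_ideal (case_sum a b) :: ('a + 'c, 'k) mpoly set"
  let ?I1 = "semigroup_ideal a :: ('a, 'k) mpoly set"
  let ?I2 = "semigroup_ideal b :: ('c, 'k) mpoly set"
  let ?f = "monom_poly (push Inl \<gamma>X) - monom_poly (push Inr \<gamma>Y) :: ('a + 'c, 'k) mpoly"
  let ?P = "gluing_pairs a b \<gamma>X \<gamma>Y"
  have "ideal_gen (rename_poly Inl ` ?I1) + ideal_gen (rename_poly Inr ` ?I2) + ideal_gen {?f} =
      ideal_gen (rename_poly Inl ` binomials (degree_pairs a) \<union>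
        rename_poly Inr ` binomials (degree_pairs b) \<union> {?f})"
    unfolding semigroup_ideal_binomials ideal_gen_rename ideal_gen_Un ..
  also have "\<dots> = ideal_gen (binomials ?P)"
    by (simp only: rename_poly_binomials gluing_pairs_def binomials_Un) (simp add: binomials_def)
  finally have sum: "ideal_gen (rename_poly Inl ` ?I1) + ideal_gen (rename_poly Inr ` ?I2) +
      ideal_gen {?f} = ideal_gen (binomials ?P)" .
  have mem: "?f \<in> ?I \<longleftrightarrow> mdegree a \<gamma>X = mdegree b \<gamma>Y"
    by (simp add: semigroup_ideal_binomials binomial_mem_ideal_iff linked_degree_pairs)
      (simp add: degree_pairs_def)
  have "?P \<subseteq> degree_pairs (case_sum a b)" if "mdegree a \<gamma>X = mdegree b \<gamma>Y"
    using that by (auto simp: gluing_pairs_def degree_pairs_def)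
  then have "?I = ideal_gen (binomials ?P) \<longleftrightarrow> degree_pairs (case_sum a b) \<subseteq> linked ?P"
    if "mdegree a \<gamma>X = mdegree b \<gamma>Y"
    using ideal_gen_binomials_eq_semigroup_ideal_iff[of ?P "case_sum a b", where 'k='k] that by auto
  then show ?thesis
    unfolding glued_binomial_def Let_def sum mem by auto
qed

text \<open>The pairs of equal degree are symmetric, so only the glued pair needs a case for each
  orientation.\<close>

lemma gluing_moves_cases:
  assumes "(v, v') \<in> moves (gluing_pairs a b \<gamma>X \<gamma>Y)"
  obtains x x' w where "v = push Inl x + w" "v' = push Inl x' + w" "mdegree a x = mdegree a x'"
  | y y' w where "v = push Inr y + w" "v' = push Inr y' + w" "mdegree b y = mdegree b y'"
  | w where "v = push Inl \<gamma>X + w" "v' = push Inr \<gamma>Y + w"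
  | w where "v = push Inr \<gamma>Y + w" "v' = push Inl \<gamma>X + w"
proof -
  from assms obtain p q w where "(p, q) \<in> gluing_pairs a b \<gamma>X \<gamma>Y \<or> (q, p) \<in> gluing_pairs a b \<gamma>X \<gamma>Y"
    and "v = p + w" "v' = q + w"
    by (auto simp: moves_def)
  with that show ?thesis
    unfolding gluing_pairs_def degree_pairs_def by (elim disjE UnE imageE) auto
qed

lemma gluing_pairs_pure:
  "(p, q) \<in> gluing_pairs a b \<gamma>X \<gamma>Y \<Longrightarrow> is_pure p \<and> is_pure q"
  by (auto simp: gluing_pairs_def is_pure_def)

section \<open>The conditions for a gluing, in both directions\<close>

locale positive_bigrading = positive_grading "case_sum a b"
  for a :: "'r::finite \<Rightarrow> 'a::comm_monoid_add" and b :: "'t::finite \<Rightarrow> 'a"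
begin

abbreviation "g \<equiv> case_sum a b"

lemma pointed_X: "mdegree a x = 0 \<Longrightarrow> x = 0"
  using pointed[of "push Inl x"] by (metis mdegree_push_Inl part_X_push(1) push_zero)

lemma pointed_Y: "mdegree b y = 0 \<Longrightarrow> y = 0"
  using pointed[of "push Inr y"] by (metis mdegree_push_Inr lookup_push_Inl_Inr(3) lookup_zero poly_mapping_eqI)

text \<open>For \<open>d \<noteq> 0\<close>, purity of the whole fibre already makes
  \<open>d\<close> a Betti degree: edges between pure monomials never lead from \<open>X\<close> to
  \<open>Y\<close>, so the complex is disconnected.\<close>

lemma pure_Betti_degree_iff:
  "pure_Betti_degree TYPE('k::field) a b d \<longleftrightarrow> d \<noteq> 0 \<and>
    (\<exists>u. only_X u \<and> mdegree g u = d) \<and> (\<exists>v. only_Y v \<and> mdegree g v = d) \<and>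
    (\<forall>u. mdegree g u = d \<longrightarrow> is_pure u)" (is "?L \<longleftrightarrow> ?R")
proof
  assume ?L
  then show ?R
    using zero_notin_Betti[where 'k='k]
    by (auto simp: pure_Betti_degree_def fibre_X_def fibre_Y_def fibre_def)
next
  assume R: ?R
  then obtain u v where uv: "only_X u" "mdegree g u = d" "only_Y v" "mdegree g v = d" by blast
  have "(u, v) \<notin> conn g"
  proof
    assume "(u, v) \<in> conn g"
    then have "only_X v"
      unfolding conn_def
    proof (induction rule: rtrancl_induct)
      case base
      show ?case by (rule uv)
    next
      case (step v v')
      have "mdegree g v = d" using step(1) uv(2) conn_mdegree[of u v g] by (simp add: conn_def)
      with step(2) have "mdegree g v' = d" by (simp add: adjacent_def)
      then show ?case
        using R step(2,3) only_X_share[of v v'] by (auto simp: adjacent_def)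
    qed
    then have "v = 0" using uv(3) only_X_Y_zero by blast
    then show False using R uv(4) by simp
  qed
  then have "d \<in> Betti TYPE('k) g" unfolding Betti_iff using uv by blast
  then show ?L using R by (auto simp: pure_Betti_degree_def fibre_X_def fibre_Y_def fibre_def)
qed

text \<open>A move between monomials without common factor uses a generator without cofactor, and every
  generator consists of pure monomials.\<close>

lemma gluing_imp_component_pure:
  assumes "glued_binomial TYPE('k::field) a b \<gamma>X \<gamma>Y" and "mdegree g u \<in> Betti TYPE('k) g"
  shows "\<exists>v. (u, v) \<in> conn g \<and> is_pure v"
proof (rule ccontr)
  assume mixed: "\<not> ?thesis"
  let ?P = "gluing_pairs a b \<gamma>X \<gamma>Y"
  have P: "?P \<subseteq> degree_pairs g"
    using assms(1) by (auto simp: glued_binomial_iff gluing_pairs_def degree_pairs_def)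
  \<comment> \<open>As long as the path from \<open>u\<close> stays in its component it meets only
    mixed monomials, so every move has a cofactor and remains in the component. The degree would
    then be connected.\<close>
  have all: "(u, v) \<in> conn g" if "mdegree g u = mdegree g v" for v
  proof -
    have "(u, v) \<in> linked ?P"
      using that assms(1) by (auto simp: glued_binomial_iff degree_pairs_def)
    then show ?thesis
      unfolding linked_def
    proof (induction rule: rtrancl_induct)
      case base
      show ?case by (rule conn_refl)
    next
      case (step v v')
      from step(2) obtain p q w where *: "(p, q) \<in> ?P \<or> (q, p) \<in> ?P" "v = p + w" "v' = q + w"
        by (auto simp: moves_def)
      have "\<not> is_pure v" using step(3) mixed by blast
      then have "w \<noteq> 0" using * gluing_pairs_pure by fastforce
      moreover have "mdegree g p = mdegree g q" using *(1) P by (auto simp: degree_pairs_def)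
      ultimately have "(v, v') \<in> conn g" unfolding * by (intro conn_add)
      with step(3) show ?case by (rule conn_trans)
    qed
  qed
  from assms(2) obtain v v' where "mdegree g v = mdegree g u" "mdegree g v' = mdegree g u" "(v, v') \<notin> conn g"
    unfolding Betti_iff by blast
  then show False using all[of v] all[of v'] conn_sym conn_trans by metis
qed

lemma glued_degree_nonzero:
  assumes "glued_binomial TYPE('k::field) a b \<gamma>X \<gamma>Y"
  shows "mdegree a \<gamma>X \<noteq> 0"
  using assms pointed_X[of \<gamma>X] pointed_Y[of \<gamma>Y] by (auto simp: glued_binomial_iff)

text \<open>Paths in the glued degree starting at the \<open>X\<close>-term stay pure: a glued move
  leaves no room for a cofactor, and the other moves cannot introduce the other kind of
  indeterminate.\<close>

lemma gluing_imp_pure_Betti_degree: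
  assumes "glued_binomial TYPE('k::field) a b \<gamma>X \<gamma>Y"
  shows "pure_Betti_degree TYPE('k) a b (mdegree a \<gamma>X)"
proof -
  let ?P = "gluing_pairs a b \<gamma>X \<gamma>Y"
  have deg: "mdegree a \<gamma>X = mdegree b \<gamma>Y" and link: "degree_pairs g \<subseteq> linked ?P"
    using assms by (auto simp: glued_binomial_iff)
  have "is_pure u" if "mdegree g u = mdegree a \<gamma>X" for u
  proof -
    have "(push Inl \<gamma>X, u) \<in> linked ?P" using that link by (auto simp: degree_pairs_def)
    then have "is_pure u \<and> mdegree g u = mdegree a \<gamma>X"
      unfolding linked_def
    proof (induction rule: rtrancl_induct)
      case base
      show ?case by (simp add: is_pure_def)
    next
      case (step v v')
      have v: "only_X v \<or> only_Y v" using step(3) by (simp add: is_pure_def)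
      have degv: "mdegree g v = mdegree a \<gamma>X" using step(3) ..
      from step(2) show ?case
      proof (cases rule: gluing_moves_cases)
        case (1 x x' w)
        \<comment> \<open>On a pure \<open>Y\<close>-monomial a move in \<open>X\<close> replaces 1
          by a monomial of degree 0, which is again 1.\<close>
        have "x' = 0" if "only_Y v"
        proof -
          have "x = 0" using that by (simp add: 1 only_Y_add)
          then show ?thesis using 1 by (intro pointed_X) simp
        qed
        then show ?thesis using v 1 degv by (auto simp: is_pure_def only_X_add only_Y_add)
      next
        case (2 y y' w)
        have "y' = 0" if "only_X v"
        proof -
          have "y = 0" using that by (simp add: 2 only_X_add)
          then show ?thesis using 2 by (intro pointed_Y) simp
        qed
        then show ?thesis using v 2 degv by (auto simp: is_pure_def only_X_add only_Y_add)
      next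
        case (3 w)
        then have "w = 0" using degv by (intro add_eq_zero_iff[of "push Inl \<gamma>X"]) simp
        then show ?thesis using 3 deg by (simp add: is_pure_def)
      next
        case (4 w)
        then have "w = 0" using degv deg by (intro add_eq_zero_iff[of "push Inr \<gamma>Y"]) simp
        then show ?thesis using 4 deg by (simp add: is_pure_def)
      qed
    qed
    then show ?thesis ..
  qed
  moreover have "\<exists>u. only_X u \<and> mdegree g u = mdegree a \<gamma>X"
    by (rule exI[of _ "push Inl \<gamma>X"]) simp
  moreover have "\<exists>v. only_Y v \<and> mdegree g v = mdegree a \<gamma>X"
    by (rule exI[of _ "push Inr \<gamma>Y"]) (simp add: deg)
  ultimately show ?thesis
    unfolding pure_Betti_degree_iff using glued_degree_nonzero[OF assms] by blast
qed

text \<open>A path from a pure \<open>X\<close>- to a pure \<open>Y\<close>-monomial through pure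
  monomials only must contain a glued move that changes the kind. Such a move has no cofactor, so
  the degree is the glued one.\<close>

lemma pure_Betti_degree_unique:
  assumes "glued_binomial TYPE('k::field) a b \<gamma>X \<gamma>Y" and "pure_Betti_degree TYPE('k) a b d"
  shows "d = mdegree a \<gamma>X"
proof (rule ccontr)
  assume neq: "d \<noteq> mdegree a \<gamma>X"
  let ?P = "gluing_pairs a b \<gamma>X \<gamma>Y"
  have deg: "mdegree a \<gamma>X = mdegree b \<gamma>Y" and link: "degree_pairs g \<subseteq> linked ?P"
    using assms(1) by (auto simp: glued_binomial_iff)
  have P: "?P \<subseteq> degree_pairs g"
    using deg by (auto simp: gluing_pairs_def degree_pairs_def)
  from assms(2) obtain u v where uv: "only_X u" "mdegree g u = d" "only_Y v" "mdegree g v = d"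
    and pure: "\<And>u. mdegree g u = d \<Longrightarrow> is_pure u" and "d \<noteq> 0"
    unfolding pure_Betti_degree_iff by blast
  have "(u, v) \<in> linked ?P" using uv link by (auto simp: degree_pairs_def)
  then have "only_X v"
    unfolding linked_def
  proof (induction rule: rtrancl_induct)
    case base
    show ?case by (rule uv)
  next
    case (step v v')
    have "(u, v) \<in> linked ?P" "(u, v') \<in> linked ?P"
      using step(1,2) unfolding linked_def by (auto intro: rtrancl_into_rtrancl)
    then have degv: "mdegree g v = d" "mdegree g v' = d"
      using linked_mdegree[OF P, of u v] linked_mdegree[OF P, of u v'] uv(2) by auto
    from step(2) show ?case
    proof (cases rule: gluing_moves_cases)
      case (1 x x' w)
      then show ?thesis using step(3) by (simp add: only_X_add)
    next
      case (2 y y' w)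
      then have "y = 0" using step(3) by (simp add: only_X_add)
      then have "y' = 0" using 2 by (intro pointed_Y) simp
      then show ?thesis using step(3) 2 by (simp add: only_X_add)
    next
      case (3 w)
      have "\<not> only_Y v'"
      proof
        assume "only_Y v'"
        then have "w = 0" using 3 step(3) only_X_Y_zero[of w] by (simp add: only_X_add only_Y_add)
        then show False using 3 degv neq by simp
      qed
      then show ?thesis using pure[OF degv(2)] by (simp add: is_pure_def)
    next
      case (4 w)
      then have "\<gamma>Y = 0" using step(3) by (simp add: only_X_add)
      then show ?thesis using glued_degree_nonzero[OF assms(1)] deg by simp
    qed
  qed
  then have "v = 0" using uv(3) only_X_Y_zero by blast
  then show False using uv(4) \<open>d \<noteq> 0\<close> by simp
qed

text \<open>Only the glued binomial changes the degree of the part in \<open>X\<close>, and it does so by the glued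
  degree; the two multiples on either side of the invariant replace an integer multiple.\<close>

lemma gluing_imp_multiple:
  assumes "glued_binomial TYPE('k::field) a b \<gamma>X \<gamma>Y"
    and "only_X u" and "only_Y v" and "mdegree g u = mdegree g v"
  shows "\<exists>n. mdegree g u = multiple n (mdegree a \<gamma>X)"
proof -
  let ?P = "gluing_pairs a b \<gamma>X \<gamma>Y" and ?d = "mdegree a \<gamma>X"
  have "(u, v) \<in> linked ?P"
    using assms by (auto simp: glued_binomial_iff degree_pairs_def)
  then have "\<exists>j k. mdegree a (part_X v) + multiple j ?d = mdegree g u + multiple k ?d"
    unfolding linked_def
  proof (induction rule: rtrancl_induct)
    case base
    have "mdegree a (part_X u) = mdegree g u"
      using mdegree_push_Inl[of a b "part_X u"] assms(2) by (simp add: only_X_eq)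
    then show ?case by (intro exI[of _ 0]) simp
  next
    case (step v v')
    then obtain j k where jk: "mdegree a (part_X v) + multiple j ?d = mdegree g u + multiple k ?d"
      by blast
    from step(2) show ?case
    proof (cases rule: gluing_moves_cases)
      case (1 x x' w)
      then have "mdegree a (part_X v') = mdegree a (part_X v)" by simp
      then show ?thesis using jk by auto
    next
      case (2 y y' w)
      then have "mdegree a (part_X v') = mdegree a (part_X v)" by simp
      then show ?thesis using jk by auto
    next
      case (3 w)
      then have "mdegree a (part_X v') + multiple (Suc j) ?d = mdegree g u + multiple k ?d"
        using jk by (simp add: ac_simps)
      then show ?thesis by blast
    next
      case (4 w)
      then have "mdegree a (part_X v') + multiple j ?d = mdegree g u + multiple (Suc k) ?d"
        using arg_cong[OF jk, of "\<lambda>x. x + ?d"] by (simp add: ac_simps)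
      then show ?thesis by blast
    qed
  qed
  \<comment> \<open>The part in \<open>X\<close> starts as all of \<open>u\<close> and ends trivial,
    so its whole degree has been traded in multiples of \<open>?d\<close>.\<close>
  moreover have "part_X v = 0"
    using assms(3) by (intro poly_mapping_eqI) (simp add: only_Y_iff)
  ultimately obtain j k where jk: "multiple j ?d = mdegree g u + multiple k ?d" by auto
  \<comment> \<open>Cancellation is available for degrees of monomials, so \<open>?d\<close> is
    represented by a monomial.\<close>
  let ?D = "push Inl \<gamma>X :: ('r + 't) monomial"
  show ?thesis
  proof (cases "k \<le> j")
    case True
    then have "multiple j ?d = multiple (j - k) ?d + multiple k ?d"
      by (metis le_add_diff_inverse2 multiple_add)
    then have "mdegree g (u + multiple k ?D) = mdegree g (multiple (j - k) ?D + multiple k ?D)"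
      using jk by (simp add: mdegree_multiple)
    then have "mdegree g u = mdegree g (multiple (j - k) ?D)" by (rule cancel)
    then show ?thesis by (auto simp: mdegree_multiple)
  next
    \<comment> \<open>Here \<open>u\<close> times a power of \<open>?D\<close> has degree 0, so
      \<open>u\<close> is 1 and the multiple is the zeroth.\<close>
    case False
    then have "multiple k ?d = multiple (k - j) ?d + multiple j ?d"
      by (metis le_add_diff_inverse2 linorder_le_cases multiple_add)
    then have "mdegree g (multiple j ?D + (u + multiple (k - j) ?D)) = mdegree g (multiple j ?D)"
      using jk by (simp add: mdegree_multiple ac_simps)
    then have "u + multiple (k - j) ?D = 0" by (rule add_eq_zero_iff)
    then have "u = 0" using keys_add_nat[of u "multiple (k - j) ?D"] by simp
    then show ?thesis by (intro exI[of _ 0]) simp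
  qed
qed

lemma linked_multiple: "(u, v) \<in> linked P \<Longrightarrow> (multiple n u, multiple n v) \<in> linked P"
  by (induction n) (auto intro: linked_refl linked_add)

text \<open>Any pure \<open>X\<close>-monomial and pure \<open>Y\<close>-monomial of degree
  \<open>d\<close> serve as the terms of the glued binomial.\<close>

lemma imp_is_gluing:
  assumes components: "\<And>u. mdegree g u \<in> Betti TYPE('k::field) g \<Longrightarrow> \<exists>v. (u, v) \<in> conn g \<and> is_pure v"
    and d: "pure_Betti_degree TYPE('k) a b d"
    and multiples: "\<And>u v. mdegree g u \<in> Betti TYPE('k) g \<Longrightarrow> only_X u \<Longrightarrow> only_Y v \<Longrightarrow>
      mdegree g u = mdegree g v \<Longrightarrow> mdegree g u \<noteq> d \<Longrightarrow> \<exists>n. mdegree g u = multiple n d"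
  shows "is_gluing TYPE('k) a b"
proof -
  from d obtain cX cY where c: "only_X cX" "mdegree g cX = d" "only_Y cY" "mdegree g cY = d" "d \<noteq> 0"
    unfolding pure_Betti_degree_iff by blast
  let ?P = "gluing_pairs a b (part_X cX) (part_Y cY)"
  have cXY: "(cX, cY) \<in> ?P"
    using c by (simp add: gluing_pairs_def only_X_eq only_Y_eq)
  have X: "(u, v) \<in> ?P" if "only_X u" "only_X v" "mdegree g u = mdegree g v" for u v
  proof -
    have "(part_X u, part_X v) \<in> degree_pairs a"
      using that mdegree_push_Inl[of a b "part_X u"] mdegree_push_Inl[of a b "part_X v"]
      by (simp add: degree_pairs_def only_X_eq)
    then have "map_prod (push Inl) (push Inl) (part_X u, part_X v) \<in> ?P"
      unfolding gluing_pairs_def by blast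
    then show ?thesis using that by (simp add: only_X_eq)
  qed
  have Y: "(u, v) \<in> ?P" if "only_Y u" "only_Y v" "mdegree g u = mdegree g v" for u v
  proof -
    have "(part_Y u, part_Y v) \<in> degree_pairs b"
      using that mdegree_push_Inr[of a b "part_Y u"] mdegree_push_Inr[of a b "part_Y v"]
      by (simp add: degree_pairs_def only_Y_eq)
    then have "map_prod (push Inr) (push Inr) (part_Y u, part_Y v) \<in> ?P"
      unfolding gluing_pairs_def by blast
    then show ?thesis using that by (simp add: only_Y_eq)
  qed
  have XY: "(u, v) \<in> linked ?P"
    if "only_X u" "only_Y v" "mdegree g u = mdegree g v" "mdegree g u \<in> Betti TYPE('k) g" for u v
  proof -
    \<comment> \<open>The assumption on multiples leaves out the degree \<open>d\<close> itself,
      which is its own first multiple.\<close>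
    have "\<exists>n. mdegree g u = multiple n d"
    proof (cases "mdegree g u = d")
      case True
      then show ?thesis by (intro exI[of _ 1]) simp
    next
      case False
      then show ?thesis using multiples that by blast
    qed
    then obtain n where n: "mdegree g u = multiple n d" ..
    have "only_X (multiple n cX)"
      by (induction n) (use c in \<open>simp_all add: only_X_add, simp add: only_X_iff\<close>)
    then have "(u, multiple n cX) \<in> linked ?P"
      using that n c by (intro linked_base X) (simp_all add: mdegree_multiple)
    moreover have "(multiple n cX, multiple n cY) \<in> linked ?P"
      using cXY by (intro linked_multiple linked_base)
    moreover have "only_Y (multiple n cY)"
      by (induction n) (use c in \<open>simp_all add: only_Y_add, simp add: only_Y_iff\<close>)
    then have "(multiple n cY, v) \<in> linked ?P"
      using that n c by (intro linked_base Y) (simp_all add: mdegree_multiple)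
    ultimately show ?thesis using linked_trans by blast
  qed
  have "(u, v) \<in> linked ?P" if "mdegree g u = mdegree g v" for u v
    using wf_below that
  proof (induction u arbitrary: v rule: wf_induct_rule)
    case (less u)
    \<comment> \<open>Stated for every \<open>z\<close> of the degree of \<open>u\<close>, since it
      is used in the components of both \<open>u\<close> and \<open>v\<close>.\<close>
    have conn: "(z, z') \<in> linked ?P" if "(z, z') \<in> conn g" "mdegree g u = mdegree g z" for z z'
      by (rule conn_imp_linked[OF that(1)]) (use less.IH below_cong that(2) in \<open>metis\<close>)
    show ?case
    proof (cases "(u, v) \<in> conn g")
      case True
      then show ?thesis by (intro conn) simp_all
    next
      case False
      then have Betti: "mdegree g u \<in> Betti TYPE('k) g" "mdegree g v \<in> Betti TYPE('k) g"
        unfolding Betti_iff using less.prems by metis+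
      from components[OF Betti(1)] obtain u' where u': "(u, u') \<in> conn g" "is_pure u'" by blast
      from components[OF Betti(2)] obtain v' where v': "(v, v') \<in> conn g" "is_pure v'" by blast
      have eq: "mdegree g u' = mdegree g u" "mdegree g v' = mdegree g u"
        using conn_mdegree[OF u'(1)] conn_mdegree[OF v'(1)] less.prems by auto
      have "(u', v') \<in> linked ?P"
        using u'(2) v'(2) unfolding is_pure_def
      proof (elim disjE)
        assume "only_X u'" "only_X v'"
        then show ?thesis using eq by (intro linked_base X) simp_all
      next
        assume "only_Y u'" "only_Y v'"
        then show ?thesis using eq by (intro linked_base Y) simp_all
      next
        assume "only_X u'" "only_Y v'"
        then show ?thesis using eq Betti by (intro XY) simp_all
      next
        assume "only_Y u'" "only_X v'"
        then show ?thesis using eq Betti by (intro linked_sym[OF XY]) simp_all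
      qed
      moreover have "(u, u') \<in> linked ?P" using u'(1) by (rule conn) simp
      moreover have "(v, v') \<in> linked ?P" using v'(1) less.prems by (rule conn)
      ultimately show ?thesis using linked_sym linked_trans by metis
    qed
  qed
  then have "degree_pairs g \<subseteq> linked ?P" by (auto simp: degree_pairs_def)
  moreover have "cX \<noteq> cY"
    using c only_X_Y_zero[of cX] by auto
  moreover have "mdegree a (part_X cX) = mdegree b (part_Y cY)"
    using c mdegree_push_Inl[of a b "part_X cX"] mdegree_push_Inr[of a b "part_Y cY"]
    by (simp add: only_X_eq only_Y_eq)
  ultimately have "glued_binomial TYPE('k) a b (part_X cX) (part_Y cY)"
    unfolding glued_binomial_iff using c by (simp add: only_X_eq only_Y_eq)
  then show ?thesis unfolding is_gluing_def by blast
qed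

text \<open>Since 0 is no Betti degree, every monomial of Betti degree is a vertex, so components
  can be addressed through their members.\<close>

lemma components_pure_iff:
  "(\<forall>d' \<in> Betti TYPE('k::field) g. \<forall>C \<in> complex_components (nabla g d'). \<exists>u\<in>C. is_pure u) \<longleftrightarrow>
    (\<forall>u. mdegree g u \<in> Betti TYPE('k) g \<longrightarrow> (\<exists>v. (u, v) \<in> conn g \<and> is_pure v))"
  (is "?L \<longleftrightarrow> ?R")
proof
  assume L: ?L
  show ?R
  proof (intro allI impI)
    fix u assume u: "mdegree g u \<in> Betti TYPE('k) g"
    then have "u \<noteq> 0" using zero_notin_Betti[where 'k='k] by auto
    then have "conn g `` {u} \<in> complex_components (nabla g (mdegree g u))"
      unfolding complex_components_nabla by blast
    with L u show "\<exists>v. (u, v) \<in> conn g \<and> is_pure v" by blast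
  qed
next
  assume ?R
  then show ?L unfolding complex_components_nabla by blast
qed

end

section \<open>Positivity of the grading from the hypotheses on the semigroup\<close>

lemma generated_remove_zero: "generated (A - {0}) = generated A"
proof
  show "generated (A - {0}) \<subseteq> generated A"
  proof
    fix x assume "x \<in> generated (A - {0})"
    then show "x \<in> generated A"
      by (induction rule: generated.induct) (auto intro: generated.intros)
  qed
  show "generated A \<subseteq> generated (A - {0})"
  proof
    fix x assume "x \<in> generated A"
    then show "x \<in> generated (A - {0})"
    proof (induction rule: generated.induct)
      case (incl x)
      then show ?case by (cases "x = 0") (auto intro: generated.intros)
    qed (auto intro: generated.intros)
  qed
qed

lemma mdegree_in_generated: "mdegree g u \<in> generated (range g)"
proof (induction u rule: poly_mapping_induct_single)
  case (single i n)
  show ?case by (induction n) (auto intro: generated.intros)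
qed (auto intro: generated.add)

lemma positive_gradingI:
  assumes S: "cancellative S" "reduced S" "minimally_generated S (range g)"
  shows "positive_grading g"
proof
  have mem: "mdegree g u \<in> S" for u
    using S(3) mdegree_in_generated by (auto simp: minimally_generated_def)
  show "mdegree g u = mdegree g v" if "mdegree g (u + w) = mdegree g (v + w)" for u v w
  proof -
    have "mdegree g w + mdegree g u = mdegree g w + mdegree g v"
      using that by (simp add: add.commute)
    then show ?thesis using S(1) mem unfolding cancellative_def by blast
  qed
  have nonzero: "g i \<noteq> 0" for i
  proof
    assume "g i = 0"
    then have "range g - {0} \<subset> range g" by (metis Diff_subset Diff_iff psubsetI rangeI singletonI)
    then show False
      using S(3) generated_remove_zero unfolding minimally_generated_def by metis
  qed
  show "u = 0" if "mdegree g u = 0" for u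
  proof (rule ccontr)
    assume "u \<noteq> 0"
    then obtain i where "i \<in> Poly_Mapping.keys u" by (metis all_not_in_conv keys_eq_empty)
    then have "Poly_Mapping.lookup (Poly_Mapping.single i 1) j \<le> Poly_Mapping.lookup u j" for j
      by (auto simp: lookup_single when_def in_keys_iff)
    then have u: "u = Poly_Mapping.single i 1 + (u - Poly_Mapping.single i 1)"
      by (rule monomial_le_imp_add)
    let ?v = "u - Poly_Mapping.single i 1"
    have "mdegree g (Poly_Mapping.single i 1) + mdegree g ?v = 0"
      using that u by (metis mdegree_add)
    moreover have "mdegree g (Poly_Mapping.single i 1) \<in> S" "mdegree g ?v \<in> S" by (rule mem)+
    ultimately have "mdegree g (Poly_Mapping.single i 1) = 0"
      using S(2) unfolding reduced_def by blast
    then show False using nonzero[of i] by simp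
  qed
qed

theorem theorem6:
  fixes S :: "'a::comm_monoid_add set"
    and a :: "'r::finite \<Rightarrow> 'a" and b :: "'t::finite \<Rightarrow> 'a"
  assumes "cancellative S" and "reduced S"
    and "inj a" and "inj b" and "range a \<inter> range b = {}"
    and "minimally_generated S (range a \<union> range b)"
  shows
    "(is_gluing TYPE('k::field) a b \<longleftrightarrow>
       (\<forall>d' \<in> Betti TYPE('k) (case_sum a b).
          \<forall>C \<in> complex_components (nabla (case_sum a b) d'). \<exists>u\<in>C. is_pure u) \<and>
       (\<exists>!d. pure_Betti_degree TYPE('k) a b d) \<and>
       (\<forall>d. pure_Betti_degree TYPE('k) a b d \<longrightarrow>
          (\<forall>d' \<in> Betti TYPE('k) (case_sum a b) - {d}.
             fibre_X a b d' \<noteq> {} \<and> fibre_Y a b d' \<noteq> {} \<longrightarrow> d' \<in> {multiple k d | k. True})))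
     \<and>
     (is_gluing TYPE('k) a b \<longrightarrow>
       (\<forall>d. pure_Betti_degree TYPE('k) a b d \<longrightarrow>
          (\<forall>e. is_glued_degree TYPE('k) a b e \<longleftrightarrow> e = d)))"
    (is "(?G \<longleftrightarrow> ?C1 \<and> ?C2 \<and> ?C3) \<and> (_ \<longrightarrow> ?D)")
proof -
  have range: "range (case_sum a b) = range a \<union> range b"
    by (simp add: UNIV_sum image_Un image_image)
  interpret positive_bigrading a b
    unfolding positive_bigrading_def by (rule positive_gradingI[of S]) (simp_all add: assms range)
  have forward: "?C1 \<and> ?C2 \<and> ?C3" if G: ?G
  proof -
    from G obtain \<gamma>X \<gamma>Y where \<gamma>: "glued_binomial TYPE('k) a b \<gamma>X \<gamma>Y" by (auto simp: is_gluing_def)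
    have ?C1
      unfolding components_pure_iff using gluing_imp_component_pure[OF \<gamma>] by blast
    moreover have ?C2
      using gluing_imp_pure_Betti_degree[OF \<gamma>] pure_Betti_degree_unique[OF \<gamma>] by (rule ex1I)
    moreover have ?C3
    proof (intro allI ballI impI)
      fix d d' assume d: "pure_Betti_degree TYPE('k) a b d"
        and "fibre_X a b d' \<noteq> {} \<and> fibre_Y a b d' \<noteq> {}"
      then obtain u v where "only_X u" "only_Y v" "mdegree g u = d'" "mdegree g v = d'"
        by (auto simp: fibre_X_def fibre_Y_def fibre_def)
      then show "d' \<in> {multiple k d | k. True}"
        using gluing_imp_multiple[OF \<gamma>, of u v] pure_Betti_degree_unique[OF \<gamma> d] by auto
    qed
    ultimately show ?thesis by blast
  qed
  have backward: ?G if C: "?C1 \<and> ?C2 \<and> ?C3"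
  proof -
    from C obtain d where d: "pure_Betti_degree TYPE('k) a b d" by blast
    show ?G
    proof (rule imp_is_gluing[OF _ d])
      show "\<exists>v. (u, v) \<in> conn g \<and> is_pure v" if "mdegree g u \<in> Betti TYPE('k) g" for u
        using C that unfolding components_pure_iff by blast
      show "\<exists>n. mdegree g u = multiple n d"
        if "mdegree g u \<in> Betti TYPE('k) g" "only_X u" "only_Y v" "mdegree g u = mdegree g v"
          "mdegree g u \<noteq> d" for u v
      proof -
        have "u \<in> fibre_X a b (mdegree g u)" "v \<in> fibre_Y a b (mdegree g u)"
          using that by (simp_all add: fibre_X_def fibre_Y_def fibre_def)
        moreover have "mdegree g u \<in> Betti TYPE('k) g - {d}" using that by blast
        moreover have "\<forall>d' \<in> Betti TYPE('k) g - {d}.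
             fibre_X a b d' \<noteq> {} \<and> fibre_Y a b d' \<noteq> {} \<longrightarrow> d' \<in> {multiple k d | k. True}"
          using C d by blast
        ultimately show ?thesis by blast
      qed
    qed
  qed
  \<comment> \<open>By uniqueness every glued binomial has degree \<open>d\<close>, and a gluing
    provides at least one.\<close>
  have degree: ?D if G: ?G
  proof (intro allI impI)
    fix d e assume d: "pure_Betti_degree TYPE('k) a b d"
    from G obtain \<gamma>X \<gamma>Y where "glued_binomial TYPE('k) a b \<gamma>X \<gamma>Y" by (auto simp: is_gluing_def)
    then show "is_glued_degree TYPE('k) a b e \<longleftrightarrow> e = d"
      using pure_Betti_degree_unique[OF _ d] unfolding is_glued_degree_def by metis
  qed
  show ?thesis
    by (rule conjI[OF iffI[OF forward backward] impI[OF degree]])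
qed

end
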